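(* Let $G$ be a simple graph on $l$ vertices, with vertex set $\Pi$, let $\mathfrak{g}$ be the Kac-Moody algebra with Dynkin diagram $G$, let $L_G$ be the bond lattice of $G$, and let $\chi(G;q)$ denote the chromatic polynomial of $G$. Then: (a) $$\chi(G;q)=\sum_{\pi\in L_G}(-1)^{l-|\pi|}\,(\operatorname{mult}\pi)\;q^{|\pi|}.$$ (b) More generally, for every $\Sigma\in L_G$, $$\chi(G(\Sigma);q)=\sum_{\hat 0\le \pi\le \Sigma}(-1)^{l-|\pi|}\,(\operatorname{mult}\pi)\;q^{|\pi|},$$ where the sum is over $\pi\in L_G$ with $\hat 0\le\pi\le\Sigma$.
   Context: $G$ is a simple graph on $l$ vertices, not assumed connected. Let $A$ be its adjacency matrix and $B:=2I-A$, a symmetric generalized Cartan matrix. $\mathfrak{g}$ is the complex Kac-Moody Lie algebra constructed from $B$ (generated by a Cartan subalgebra $\mathfrak{h}$ from a minimal realization of $B$ and Chevalley generators $e_i,f_i$ subject to the Chevalley-Serre relations). Its root space decomposition is $\mathfrak{g}=\mathfrak{h}\oplus\bigoplus_{\alpha\in\Delta_+}(\mathfrak{g}_\alpha\oplus\mathfrak{g}_{-\alpha})$ with $\Delta_+$ the set of positive roots; $\operatorname{mult}\alpha:=\dim\mathfrak{g}_\alpha$. The set $\Pi$ of simple roots is identified with the vertex set of $G$. For $S\subset\Pi$, $G(S)$ is the subgraph of $G$ induced by $S$, and $\beta(S):=\sum_{\alpha\in S}\alpha$. A non-empty $S$ is called connected if $G(S)$ is connected (equivalently $\operatorname{mult}\beta(S)>0$).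 The bond lattice $L_G$ is the set of all partitions $\pi=\{S_1,\dots,S_k\}$ of $\Pi$ into non-empty pairwise disjoint connected subsets, partially ordered by refinement: $\pi\ge\pi'$ iff $\pi'$ refines $\pi$. Here $|\pi|:=k$ is the number of parts, and $\hat 0$ is the partition into $l$ singletons, the unique minimal element. For $\pi=\{S_1,\dots,S_k\}\in L_G$, $\operatorname{mult}\pi:=\prod_{i=1}^k\operatorname{mult}\beta(S_i)$. For $\Sigma=\{S_1,\dots,S_k\}\in L_G$, $G(\Sigma)$ is the (disjoint) union of the induced subgraphs $G(S_i)$, $i=1,\dots,k$. The chromatic polynomial of a graph is the polynomial in $q$ whose value at each positive integer $q$ is the number of proper vertex colorings with $q$ colors. *)

theory Defs
  imports
    Complex_Main
    "HOL-Library.Disjoint_Sets"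
    "HOL-Library.FuncSet"
    "HOL-Library.Function_Algebras"
    "HOL-Computational_Algebra.Polynomial"
    "Graph_Theory.Digraph_Component"
begin

section \<open>Graphs, colourings and the bond lattice\<close>

text \<open>
  A simple graph is a digraph satisfying the locale \<^locale>\<open>graph\<close>: finite, symmetric,
  without loops and without parallel arcs. It may be disconnected or empty.
\<close>

definition proper_colourings :: "('a, 'b) pre_digraph \<Rightarrow> nat \<Rightarrow> ('a \<Rightarrow> nat) set" where
  "proper_colourings G q =
     {c \<in> verts G \<rightarrow>\<^sub>E {..<q}. \<forall>u v. u \<rightarrow>\<^bsub>G\<^esub> v \<longrightarrow> c u \<noteq> c v}"

definition chromatic_polynomial :: "('a, 'b) pre_digraph \<Rightarrow> int poly" where
  "chromatic_polynomial G =
     (THE p. \<forall>q>0. poly p (int q) = int (card (proper_colourings G q)))"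

text \<open>\<open>Digraph_Component.connected\<close> includes non-emptiness of the vertex set.\<close>

definition bond_lattice :: "('a, 'b) pre_digraph \<Rightarrow> 'a set set set" where
  "bond_lattice G =
     {\<pi>. partition_on (verts G) \<pi> \<and> (\<forall>S\<in>\<pi>. Digraph_Component.connected (G \<restriction> S))}"

definition bond_bot :: "('a, 'b) pre_digraph \<Rightarrow> 'a set set" where
  "bond_bot G = (\<lambda>v. {v}) ` verts G"

definition bond_subgraph :: "('a, 'b) pre_digraph \<Rightarrow> 'a set set \<Rightarrow> ('a, 'b) pre_digraph" where
  "bond_subgraph G \<Sigma> = pre_digraph.Union G ((\<lambda>S. G \<restriction> S) ` \<Sigma>)"

definition adjacency_matrix :: "('a, 'b) pre_digraph \<Rightarrow> 'a \<Rightarrow> 'a \<Rightarrow> int" where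
  "adjacency_matrix G i j = (if i \<rightarrow>\<^bsub>G\<^esub> j then 1 else 0)"

definition cartan_matrix :: "('a, 'b) pre_digraph \<Rightarrow> 'a \<Rightarrow> 'a \<Rightarrow> int" where
  "cartan_matrix G i j = (if i = j then 2 else 0) - adjacency_matrix G i j"


section \<open>Lie algebras by generators and relations\<close>

locale lie_algebra = vector_space scale
  for scale :: "complex \<Rightarrow> 'g::ab_group_add \<Rightarrow> 'g" +
  fixes bracket :: "'g \<Rightarrow> 'g \<Rightarrow> 'g"
  assumes bracket_add_left: "bracket (x + y) z = bracket x z + bracket y z"
    and bracket_add_right: "bracket x (y + z) = bracket x y + bracket x z"
    and bracket_scale_left: "bracket (scale c x) y = scale c (bracket x y)"
    and bracket_scale_right: "bracket x (scale c y) = scale c (bracket x y)"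
    and bracket_self: "bracket x x = 0"
    and jacobi: "bracket x (bracket y z) + bracket y (bracket z x) + bracket z (bracket x y) = 0"

text \<open>Formal Lie algebra expressions in a set of generators.\<close>

datatype (gens: 'x) lie_expr =
    Gen 'x
  | Zero
  | Add "'x lie_expr" "'x lie_expr"
  | Smul complex "'x lie_expr"
  | Brk "'x lie_expr" "'x lie_expr"

text \<open>
  \<open>lie_cong R s t\<close>: the identity \<open>s = t\<close> follows from the relations \<open>R\<close> and the axioms of a
  complex Lie algebra. Expressions modulo this congruence form the Lie algebra presented by \<open>R\<close>.
\<close>

inductive lie_cong :: "('x lie_expr \<times> 'x lie_expr) set \<Rightarrow> 'x lie_expr \<Rightarrow> 'x lie_expr \<Rightarrow> bool"
  for R where
    rel: "(s, t) \<in> R \<Longrightarrow> lie_cong R s t"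
  | refl: "lie_cong R s s"
  | sym: "lie_cong R s t \<Longrightarrow> lie_cong R t s"
  | trans: "lie_cong R s t \<Longrightarrow> lie_cong R t u \<Longrightarrow> lie_cong R s u"
  | cong_Add: "lie_cong R s s' \<Longrightarrow> lie_cong R t t' \<Longrightarrow> lie_cong R (Add s t) (Add s' t')"
  | cong_Smul: "lie_cong R s s' \<Longrightarrow> lie_cong R (Smul c s) (Smul c s')"
  | cong_Brk: "lie_cong R s s' \<Longrightarrow> lie_cong R t t' \<Longrightarrow> lie_cong R (Brk s t) (Brk s' t')"
  | add_assoc: "lie_cong R (Add (Add s t) u) (Add s (Add t u))"
  | add_commute: "lie_cong R (Add s t) (Add t s)"
  | add_zero: "lie_cong R (Add Zero s) s"
  | add_inverse: "lie_cong R (Add s (Smul (-1) s)) Zero"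
  | smul_add_right: "lie_cong R (Smul c (Add s t)) (Add (Smul c s) (Smul c t))"
  | smul_add_left: "lie_cong R (Smul (c + d) s) (Add (Smul c s) (Smul d s))"
  | smul_smul: "lie_cong R (Smul c (Smul d s)) (Smul (c * d) s)"
  | smul_one: "lie_cong R (Smul 1 s) s"
  | brk_add_left: "lie_cong R (Brk (Add s t) u) (Add (Brk s u) (Brk t u))"
  | brk_add_right: "lie_cong R (Brk s (Add t u)) (Add (Brk s t) (Brk s u))"
  | brk_smul_left: "lie_cong R (Brk (Smul c s) t) (Smul c (Brk s t))"
  | brk_smul_right: "lie_cong R (Brk s (Smul c t)) (Smul c (Brk s t))"
  | brk_self: "lie_cong R (Brk s s) Zero"
  | brk_jacobi: "lie_cong R (Add (Brk s (Brk t u)) (Add (Brk t (Brk u s)) (Brk u (Brk s t)))) Zero"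

context lie_algebra
begin

primrec lie_eval :: "('x \<Rightarrow> 'g) \<Rightarrow> 'x lie_expr \<Rightarrow> 'g" where
  "lie_eval \<phi> (Gen x) = \<phi> x"
| "lie_eval \<phi> Zero = 0"
| "lie_eval \<phi> (Add s t) = lie_eval \<phi> s + lie_eval \<phi> t"
| "lie_eval \<phi> (Smul c s) = scale c (lie_eval \<phi> s)"
| "lie_eval \<phi> (Brk s t) = bracket (lie_eval \<phi> s) (lie_eval \<phi> t)"

text \<open>
  The map \<open>\<phi>\<close> exhibits the Lie algebra as the one with generating set \<open>X\<close> and defining relations
  \<open>R\<close> (assumed to involve generators from \<open>X\<close> only): evaluation induces a bijection, hence an
  isomorphism, from the expressions over \<open>X\<close> modulo \<open>lie_cong R\<close>.
\<close>

definition presented_by ::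
    "('x \<Rightarrow> 'g) \<Rightarrow> 'x set \<Rightarrow> ('x lie_expr \<times> 'x lie_expr) set \<Rightarrow> bool" where
  "presented_by \<phi> X R \<longleftrightarrow>
     (\<forall>y. \<exists>t. gens t \<subseteq> X \<and> lie_eval \<phi> t = y) \<and>
     (\<forall>s t. gens s \<subseteq> X \<longrightarrow> gens t \<subseteq> X \<longrightarrow>
        (lie_eval \<phi> s = lie_eval \<phi> t \<longleftrightarrow> lie_cong R s t))"

end


section \<open>Minimal realizations\<close>

text \<open>Rank over the complex numbers of the matrix \<open>B\<close> with rows and columns indexed by \<open>I\<close>.\<close>

definition matrix_rank :: "'a set \<Rightarrow> ('a \<Rightarrow> 'a \<Rightarrow> int) \<Rightarrow> nat" where
  "matrix_rank I B =
     vector_space.dim (\<lambda>(c::complex) (x :: 'a \<Rightarrow> complex) j. c * x j)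
       ((\<lambda>i j. if j \<in> I then of_int (B i j) else 0) ` I)"

text \<open>
  The Cartan subalgebra is the whole type \<^typ>\<open>'h\<close>. The roots are elements of its dual,
  represented as linear functionals. Finite-dimensionality is stated separately because
  \<open>dim\<close> is \<open>0\<close> on infinite-dimensional spaces.
\<close>

locale minimal_realization = vector_space scale_h
  for scale_h :: "complex \<Rightarrow> 'h::ab_group_add \<Rightarrow> 'h" +
  fixes I :: "'a set"
    and B :: "'a \<Rightarrow> 'a \<Rightarrow> int"
    and simple_coroot :: "'a \<Rightarrow> 'h"
    and simple_root :: "'a \<Rightarrow> 'h \<Rightarrow> complex"
  assumes finite_dimensional: "\<exists>C. finite C \<and> span C = UNIV"
    and dim_eq: "dim UNIV = 2 * card I - matrix_rank I B"
    and root_linear: "\<And>i. i \<in> I \<Longrightarrow> Vector_Spaces.linear scale_h (*) (simple_root i)"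
    and coroots_independent: "inj_on simple_coroot I" "\<not> dependent (simple_coroot ` I)"
    and roots_independent: "inj_on simple_root I"
      "\<not> module.dependent (\<lambda>(c::complex) (\<phi> :: 'h \<Rightarrow> complex) x. c * \<phi> x) (simple_root ` I)"
    and pairing: "\<And>i j. i \<in> I \<Longrightarrow> j \<in> I \<Longrightarrow> simple_root j (simple_coroot i) = of_int (B i j)"


section \<open>Kac-Moody algebras\<close>

datatype ('a, 'h) km_gen = Cartan 'h | ChevE 'a | ChevF 'a

abbreviation "\<h> x \<equiv> Gen (Cartan x)"
abbreviation "\<e> i \<equiv> Gen (ChevE i)"
abbreviation "\<f> i \<equiv> Gen (ChevF i)"

definition km_gens :: "'a set \<Rightarrow> ('a, 'h) km_gen set" where
  "km_gens I = range Cartan \<union> ChevE ` I \<union> ChevF ` I"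

text \<open>
  Chevalley-Serre relations. The first two make the Cartan generators depend linearly on the
  underlying vector.
\<close>

inductive_set km_relations ::
    "(complex \<Rightarrow> 'h::ab_group_add \<Rightarrow> 'h) \<Rightarrow> 'a set \<Rightarrow> ('a \<Rightarrow> 'a \<Rightarrow> int) \<Rightarrow> ('a \<Rightarrow> 'h) \<Rightarrow>
     ('a \<Rightarrow> 'h \<Rightarrow> complex) \<Rightarrow> (('a, 'h) km_gen lie_expr \<times> ('a, 'h) km_gen lie_expr) set"
  for scale_h :: "complex \<Rightarrow> 'h::ab_group_add \<Rightarrow> 'h" and I :: "'a set"
    and B :: "'a \<Rightarrow> 'a \<Rightarrow> int" and simple_coroot :: "'a \<Rightarrow> 'h" and simple_root :: "'a \<Rightarrow> 'h \<Rightarrow> complex"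
  where
    cartan_add: "(\<h> (x + y), Add (\<h> x) (\<h> y)) \<in> km_relations scale_h I B simple_coroot simple_root"
  | cartan_scale: "(\<h> (scale_h c x), Smul c (\<h> x)) \<in> km_relations scale_h I B simple_coroot simple_root"
  | hh: "(Brk (\<h> x) (\<h> y), Zero) \<in> km_relations scale_h I B simple_coroot simple_root"
  | ef: "i \<in> I \<Longrightarrow> (Brk (\<e> i) (\<f> i), \<h> (simple_coroot i)) \<in> km_relations scale_h I B simple_coroot simple_root"
  | ef_ne: "i \<in> I \<Longrightarrow> j \<in> I \<Longrightarrow> i \<noteq> j \<Longrightarrow>
      (Brk (\<e> i) (\<f> j), Zero) \<in> km_relations scale_h I B simple_coroot simple_root"
  | he: "i \<in> I \<Longrightarrow>
      (Brk (\<h> x) (\<e> i), Smul (simple_root i x) (\<e> i)) \<in> km_relations scale_h I B simple_coroot simple_root"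
  | hf: "i \<in> I \<Longrightarrow>
      (Brk (\<h> x) (\<f> i), Smul (- simple_root i x) (\<f> i)) \<in> km_relations scale_h I B simple_coroot simple_root"
  | serre_e: "i \<in> I \<Longrightarrow> j \<in> I \<Longrightarrow> i \<noteq> j \<Longrightarrow>
      ((Brk (\<e> i) ^^ nat (1 - B i j)) (\<e> j), Zero) \<in> km_relations scale_h I B simple_coroot simple_root"
  | serre_f: "i \<in> I \<Longrightarrow> j \<in> I \<Longrightarrow> i \<noteq> j \<Longrightarrow>
      ((Brk (\<f> i) ^^ nat (1 - B i j)) (\<f> j), Zero) \<in> km_relations scale_h I B simple_coroot simple_root"

text \<open>
  The Kac-Moody algebra of the matrix \<open>B\<close> on the index set \<open>I\<close>. It carries the canonical map
  \<open>\<iota>\<close> from the Cartan subalgebra of the realization and Chevalley generators \<open>e\<close>, \<open>f\<close>.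
\<close>

locale kac_moody_algebra =
  H: minimal_realization scale_h I B simple_coroot simple_root + lie_algebra scale bracket
  for scale_h :: "complex \<Rightarrow> 'h::ab_group_add \<Rightarrow> 'h"
    and I :: "'a set"
    and B :: "'a \<Rightarrow> 'a \<Rightarrow> int"
    and simple_coroot :: "'a \<Rightarrow> 'h"
    and simple_root :: "'a \<Rightarrow> 'h \<Rightarrow> complex"
    and scale :: "complex \<Rightarrow> 'g::ab_group_add \<Rightarrow> 'g"
    and bracket :: "'g \<Rightarrow> 'g \<Rightarrow> 'g" +
  fixes \<iota> :: "'h \<Rightarrow> 'g"
    and e f :: "'a \<Rightarrow> 'g"
  assumes presentation:
    "presented_by (case_km_gen \<iota> e f) (km_gens I) (km_relations scale_h I B simple_coroot simple_root)"

definition root_space ::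
    "(complex \<Rightarrow> 'g::ab_group_add \<Rightarrow> 'g) \<Rightarrow> ('g \<Rightarrow> 'g \<Rightarrow> 'g) \<Rightarrow> ('h \<Rightarrow> 'g) \<Rightarrow>
     ('h \<Rightarrow> complex) \<Rightarrow> 'g set" where
  "root_space scale bracket \<iota> \<alpha> = {x. \<forall>h. bracket (\<iota> h) x = scale (\<alpha> h) x}"

definition root_mult ::
    "(complex \<Rightarrow> 'g::ab_group_add \<Rightarrow> 'g) \<Rightarrow> ('g \<Rightarrow> 'g \<Rightarrow> 'g) \<Rightarrow> ('h \<Rightarrow> 'g) \<Rightarrow>
     ('h \<Rightarrow> complex) \<Rightarrow> nat" where
  "root_mult scale bracket \<iota> \<alpha> = vector_space.dim scale (root_space scale bracket \<iota> \<alpha>)"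

text \<open>Here \<open>\<Sum>i\<in>S. simple_root i\<close> is a pointwise sum of functionals.\<close>

definition partition_mult ::
    "(complex \<Rightarrow> 'g::ab_group_add \<Rightarrow> 'g) \<Rightarrow> ('g \<Rightarrow> 'g \<Rightarrow> 'g) \<Rightarrow> ('h \<Rightarrow> 'g) \<Rightarrow>
     ('a \<Rightarrow> 'h \<Rightarrow> complex) \<Rightarrow> 'a set set \<Rightarrow> nat" where
  "partition_mult scale bracket \<iota> simple_root \<pi> =
     (\<Prod>S\<in>\<pi>. root_mult scale bracket \<iota> (\<Sum>i\<in>S. simple_root i))"

end

theory Submission
  imports Defs
begin

text \<open>
  For connected \<open>S\<close> and any \<open>v \<in> S\<close>, the root space of \<open>\<beta>(S)\<close> is spanned by the brackets
  \<open>[e\<^sub>i\<^sub>1, [e\<^sub>i\<^sub>2, \<dots>, [e\<^sub>i\<^sub>k, e\<^sub>v]\<dots>]]\<close> over the orderings of \<open>S\<close> ending in \<open>v\<close>. Generators of non-adjacent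
  vertices commute, so such a bracket depends only on the acyclic orientation of \<open>G(S)\<close> induced by the
  ordering, and it vanishes unless \<open>v\<close> is the only sink. The remaining brackets are linearly independent:
  they are separated by matrix coefficients of a dual Verma module, in multilinear degree of which the
  Serre relations only say that non-adjacent letters commute. Hence \<open>mult \<beta>(S)\<close> is the number of acyclic
  orientations of \<open>G(S)\<close> with \<open>v\<close> as only sink.

  A signed count of orientations with marked sources shows that, for the convolution of set functions,
  \<open>(-1)\<^bsup>|S| - 1\<^esup> mult \<beta>(S)\<close> is the logarithm of the indicator of stable sets. The number of
  colourings is the \<open>q\<close>-th power of that indicator, that is, the exponential of \<open>q\<close> times this logarithm,
  which is the asserted sum over partitions.
\<close>

section \<open>Acyclic orientations and colourings\<close>

text \<open>The obstacle is the lower bound on the dimension. The algebra is known only through its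
  presentation, which yields spanning sets and vanishing at once but never shows that an element is
  nonzero, so a module is built by hand in which every relation can be verified. On the free module
  on words, where e acts by prepending a letter, the Serre relations among the e fail, and a
  quotient would require control of an ideal. Passing to functions on words turns the quotient into
  a subspace: membership is a check on values, and the indicator of one orientation passes it.

  That the number of orientations with only sink v does not depend on v is a statement of its own in
  combinatorics. Here it comes from the algebra, since the same dimension is computed for every v;
  the combinatorial half takes it as an assumption and may then single out any vertex of any block.

  Part (b) involves no second Lie algebra. Orientations are counted in G(\<Sigma>): for a set inside
  one block the count agrees with that for G, for any other set it is zero.\<close>

primrec word_orientation :: "('a \<Rightarrow> 'a \<Rightarrow> bool) \<Rightarrow> 'a list \<Rightarrow> ('a \<times> 'a) set" where
  "word_orientation A [] = {}"
| "word_orientation A (x # w) = {x} \<times> {y \<in> set w. A x y} \<union> word_orientation A w"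

text \<open>
  Every acyclic orientation is induced by a linear order of the vertices. The rooted ones are those
  whose only sink is \<open>v\<close>.
\<close>

definition acyclic_orientations :: "('a \<Rightarrow> 'a \<Rightarrow> bool) \<Rightarrow> 'a set \<Rightarrow> ('a \<times> 'a) set set" where
  "acyclic_orientations A S = word_orientation A ` {w. distinct w \<and> set w = S}"

definition rooted_orientations :: "('a \<Rightarrow> 'a \<Rightarrow> bool) \<Rightarrow> 'a \<Rightarrow> 'a set \<Rightarrow> ('a \<times> 'a) set set" where
  "rooted_orientations A v S = {R \<in> acyclic_orientations A S. S - {v} \<subseteq> Domain R}"

definition stable :: "('a \<Rightarrow> 'a \<Rightarrow> bool) \<Rightarrow> 'a set \<Rightarrow> bool" where
  "stable A S \<longleftrightarrow> (\<forall>x\<in>S. \<forall>y\<in>S. \<not> A x y)"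

definition colourings :: "('a \<Rightarrow> 'a \<Rightarrow> bool) \<Rightarrow> 'a set \<Rightarrow> nat \<Rightarrow> ('a \<Rightarrow> nat) set" where
  "colourings A S q = {c \<in> S \<rightarrow>\<^sub>E {..<q}. \<forall>x\<in>S. \<forall>y\<in>S. A x y \<longrightarrow> c x \<noteq> c y}"

lemma word_orientation_subset: "word_orientation A w \<subseteq> set w \<times> set w"
  by (induction w) auto

lemma word_orientation_adj: "(x, y) \<in> word_orientation A w \<Longrightarrow> A x y"
  by (induction w) auto

lemma word_orientation_append:
  "word_orientation A (u @ w) =
     word_orientation A u \<union> word_orientation A w \<union> {(x, y). x \<in> set u \<and> y \<in> set w \<and> A x y}"
  by (induction u) auto

lemma word_orientation_filter:
  "word_orientation A (filter P w) = word_orientation A w \<inter> {x. P x} \<times> {y. P y}"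
  by (induction w) auto

lemma word_orientation_antisym:
  "distinct w \<Longrightarrow> (x, y) \<in> word_orientation A w \<Longrightarrow> (y, x) \<notin> word_orientation A w"
  using word_orientation_subset[of A] by (induction w) auto

lemma word_orientation_stable: "stable A (set w) \<Longrightarrow> word_orientation A w = {}"
  by (induction w) (auto simp: stable_def)

text \<open>The first letter with a later neighbour is a source: an earlier neighbour of it would
  itself have a later one.\<close>

lemma word_orientation_source:
  assumes "word_orientation A w \<noteq> {}"
  shows "\<exists>x \<in> Domain (word_orientation A w). distinct w \<longrightarrow> x \<notin> Range (word_orientation A w)"
  using assms
proof (induction w)
  case (Cons x w)
  show ?case
  proof (cases "\<exists>y\<in>set w. A x y")
    case True
    then show ?thesis
      using word_orientation_subset[of A w] by (intro bexI[of _ x]) auto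
  next
    case False
    then have "word_orientation A (x # w) = word_orientation A w" by auto
    then show ?thesis using Cons by (simp del: word_orientation.simps) auto
  qed
qed simp

lemma last_not_in_Domain:
  assumes "distinct (u @ [v])"
  shows "v \<notin> Domain (word_orientation A (u @ [v]))"
  using assms word_orientation_subset[of A u] by (auto simp: word_orientation_append)

text \<open>Toggling a fixed element of \<open>B - C\<close> is a sign-reversing involution of the
  interval, so the sum equals its own negative. If \<open>C\<close> is not contained in
  \<open>B\<close>, the interval is empty.\<close>

lemma sum_signed_interval:
  assumes "finite B"
  shows "(\<Sum>T | C \<subseteq> T \<and> T \<subseteq> B. (- 1) ^ card T) = (if C = B then (- 1) ^ card B else (0::int))"
proof (cases "C \<subset> B")
  case True
  then obtain b where b: "b \<in> B" "b \<notin> C" by auto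
  let ?F = "{T. C \<subseteq> T \<and> T \<subseteq> B}"
  let ?tog = "\<lambda>T. if b \<in> T then T - {b} else insert b T"
  have "(\<Sum>T\<in>?F. (- 1) ^ card T) = (\<Sum>T\<in>?F. - ((- 1) ^ card T) :: int)"
  proof (rule sum.reindex_bij_witness[where i = ?tog and j = ?tog])
    fix T assume T: "T \<in> ?F"
    then have "finite T" using assms finite_subset by blast
    then show "- ((- 1) ^ card (?tog T)) = ((- 1) ^ card T :: int)"
      by (cases "card T") (auto simp: card_Diff_singleton)
  qed (use b in auto)
  then show ?thesis using True by (auto simp: sum_negf)
next
  case False
  then have "{T. C \<subseteq> T \<and> T \<subseteq> B} = (if C = B then {B} else {})" by auto
  then show ?thesis by auto
qed

locale adjacency =
  fixes A :: "'a \<Rightarrow> 'a \<Rightarrow> bool"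
  assumes adj_sym: "A x y \<Longrightarrow> A y x" and adj_irrefl: "\<not> A x x"
begin

lemma word_orientation_total:
  assumes "x \<in> set w" "y \<in> set w" "A x y"
  shows "(x, y) \<in> word_orientation A w \<or> (y, x) \<in> word_orientation A w"
  using assms by (induction w) (auto simp: adj_irrefl dest: adj_sym)

lemma finite_acyclic_orientations: "finite S \<Longrightarrow> finite (acyclic_orientations A S)"
  unfolding acyclic_orientations_def
  by (intro finite_imageI finite_subset[OF _ finite_subset_distinct[of S]]) auto

lemma finite_rooted_orientations: "finite S \<Longrightarrow> finite (rooted_orientations A v S)"
  unfolding rooted_orientations_def by (simp add: finite_acyclic_orientations)

lemma acyclic_orientationE:
  assumes "R \<in> acyclic_orientations A S"
  obtains w where "distinct w" "set w = S" "R = word_orientation A w"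
  using assms by (auto simp: acyclic_orientations_def)

lemma empty_acyclic_orientation:
  assumes "finite S"
  shows "{} \<in> acyclic_orientations A S \<longleftrightarrow> stable A S"
proof
  assume "{} \<in> acyclic_orientations A S"
  then obtain w where "distinct w" "set w = S" "{} = word_orientation A w"
    by (rule acyclic_orientationE)
  then show "stable A S"
    using word_orientation_total[of _ w] by (auto simp: stable_def)
next
  assume "stable A S"
  moreover obtain w where "distinct w" "set w = S" using finite_distinct_list[OF assms] by blast
  ultimately show "{} \<in> acyclic_orientations A S"
    using word_orientation_stable[of A w] by (force simp: acyclic_orientations_def)
qed

text \<open>
  Adding the vertices of \<open>T\<close> as sources below an orientation of \<open>S - T\<close> is inverse to deleting them.
\<close>

lemma card_orientations_with_sources:
  assumes "finite S" "stable A T" "T \<subseteq> S - {v}"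
  shows "card {R \<in> acyclic_orientations A S. T \<inter> Range R = {} \<and> S - T - {v} \<subseteq> Domain R} =
         card (rooted_orientations A v (S - T))" (is "card ?L = card ?R")
proof (rule bij_betw_same_card)
  let ?E = "{(x, y). x \<in> T \<and> y \<in> S - T \<and> A x y}"
  let ?f = "\<lambda>R. R \<inter> (S - T) \<times> (S - T)"
  show "bij_betw ?f ?L ?R"
  proof (rule bij_betw_byWitness[where f' = "\<lambda>R. R \<union> ?E"])
    show "\<forall>R\<in>?L. ?f R \<union> ?E = R"
    proof
      fix R assume R: "R \<in> ?L"
      then obtain w where w: "distinct w" "set w = S" "R = word_orientation A w"
        by (auto elim: acyclic_orientationE)
      have RS: "R \<subseteq> S \<times> S" using w word_orientation_subset by blast
      have "(x, y) \<in> R" if "(x, y) \<in> ?E" for x y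
        using that R assms(3) w word_orientation_total[of x w y] by blast
      moreover have "(x, y) \<in> ?f R \<union> ?E" if "(x, y) \<in> R" for x y
        using that R RS w word_orientation_adj[of x y A w] by blast
      ultimately show "?f R \<union> ?E = R" by blast
    qed
    show "\<forall>R\<in>?R. ?f (R \<union> ?E) = R"
    proof
      fix R assume "R \<in> ?R"
      then obtain w where "set w = S - T" "R = word_orientation A w"
        by (auto simp: rooted_orientations_def acyclic_orientations_def)
      then have "R \<subseteq> (S - T) \<times> (S - T)" using word_orientation_subset by blast
      then show "?f (R \<union> ?E) = R" by blast
    qed
    show "?f ` ?L \<subseteq> ?R"
    proof
      fix R' assume "R' \<in> ?f ` ?L"
      then obtain R where R: "R \<in> ?L" "R' = ?f R" by blast
      then obtain w where w: "distinct w" "set w = S" "R = word_orientation A w"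
        by (auto elim: acyclic_orientationE)
      have RS: "R \<subseteq> S \<times> S" using w word_orientation_subset by blast
      have "R' = word_orientation A (filter (\<lambda>x. x \<notin> T) w)"
        using w RS R by (auto simp: word_orientation_filter)
      then have "R' \<in> acyclic_orientations A (S - T)"
        using w by (auto simp: acyclic_orientations_def)
      moreover have "S - T - {v} \<subseteq> Domain R'"
      proof
        fix x assume x: "x \<in> S - T - {v}"
        then obtain y where "(x, y) \<in> R" using R by blast
        then show "x \<in> Domain R'" using R RS x by blast
      qed
      ultimately show "R' \<in> ?R" by (simp add: rooted_orientations_def)
    qed
    show "(\<lambda>R. R \<union> ?E) ` ?R \<subseteq> ?L"
    proof
      fix R assume "R \<in> (\<lambda>R. R \<union> ?E) ` ?R"
      then obtain R' where R': "R' \<in> ?R" "R = R' \<union> ?E" by blast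
      then obtain w where w: "distinct w" "set w = S - T" "R' = word_orientation A w"
        by (auto simp: rooted_orientations_def elim: acyclic_orientationE)
      obtain xs where xs: "distinct xs" "set xs = T"
        using finite_distinct_list assms finite_subset by (metis finite_Diff)
      have "R = word_orientation A (xs @ w)"
        using R' w xs assms(2) word_orientation_stable[of A xs] by (auto simp: word_orientation_append)
      then have "R \<in> acyclic_orientations A S"
        using w xs assms(3) by (auto simp: acyclic_orientations_def intro!: image_eqI)
      moreover have "T \<inter> Range R = {}"
        using R' w word_orientation_subset[of A w] by auto
      ultimately show "R \<in> ?L" using R' by (auto simp: rooted_orientations_def)
    qed
  qed
qed

text \<open>Reversing the word exchanges sources and sinks, so one search for an extremal vertex
  serves both.\<close>

lemma reflected_word_orientation: "(word_orientation A w)\<inverse> = word_orientation A (rev w)"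
  by (induction w) (auto simp: word_orientation_append dest: adj_sym)

lemma word_orientation_sink:
  assumes "word_orientation A w \<noteq> {}" "distinct w"
  shows "\<exists>x \<in> Range (word_orientation A w). x \<notin> Domain (word_orientation A w)"
  using word_orientation_source[of A "rev w"] assms
  by (auto simp flip: reflected_word_orientation)

text \<open>Double counting of pairs of an orientation R of S and a set T of marked sources that
  contains every sink other than v. For fixed R the admissible T form an interval of sets, whose
  signed sum vanishes unless its two ends coincide; only the empty orientation survives.\<close>

lemma signed_rooted_orientations:
  assumes "finite S" "v \<in> S"
  shows "(\<Sum>T | T \<subseteq> S - {v} \<and> stable A T.
            (- 1) ^ card T * int (card (rooted_orientations A v (S - T)))) =
         (if stable A S then (- 1) ^ (card S - 1) else 0)"
proof -
  let ?\<O> = "acyclic_orientations A S"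
  let ?\<T> = "{T. T \<subseteq> S - {v} \<and> stable A T}"
  let ?C = "\<lambda>R. S - {v} - Domain R" and ?D = "\<lambda>R. S - {v} - Range R"
  have fin: "finite ?\<O>" "finite ?\<T>"
    using assms by (auto simp: finite_acyclic_orientations)
  \<comment> \<open>\<open>?C R\<close> consists of the sinks and \<open>?D R\<close> of the sources
    other than v. Stability of T follows from the upper bound, since an edge inside T would have its
    head in the range of R.\<close>
  have between: "T \<subseteq> S - {v} \<and> stable A T \<and> T \<inter> Range R = {} \<and> S - T - {v} \<subseteq> Domain R \<longleftrightarrow>
        ?C R \<subseteq> T \<and> T \<subseteq> ?D R" if R: "R \<in> ?\<O>" for R T
  proof -
    obtain w where w: "distinct w" "set w = S" "R = word_orientation A w"
      using R by (rule acyclic_orientationE)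
    have "stable A T" if T: "T \<subseteq> ?D R"
      unfolding stable_def
    proof (intro ballI notI)
      fix x y assume xy: "x \<in> T" "y \<in> T" "A x y"
      then have "(x, y) \<in> R \<or> (y, x) \<in> R"
        using T w word_orientation_total[of x w y] by blast
      then show False using T xy by blast
    qed
    moreover have "S - T - {v} \<subseteq> Domain R \<longleftrightarrow> ?C R \<subseteq> T" by blast
    moreover have "T \<subseteq> S - {v} \<and> T \<inter> Range R = {} \<longleftrightarrow> T \<subseteq> ?D R" by blast
    ultimately show ?thesis by metis
  qed
  \<comment> \<open>A nonempty R has a source with an outgoing arc and a sink with an incoming one.
    If the ends coincide, neither can differ from v, so v would be both.\<close>
  have extremal: "?C R = ?D R \<longleftrightarrow> R = {}" if R: "R \<in> ?\<O>" for R
  proof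
    assume eq: "?C R = ?D R"
    show "R = {}"
    proof (rule ccontr)
      assume "R \<noteq> {}"
      obtain w where w: "distinct w" "set w = S" "R = word_orientation A w"
        using R by (rule acyclic_orientationE)
      have "R \<subseteq> S \<times> S" using w word_orientation_subset by blast
      moreover obtain x where x: "x \<in> Domain R" "x \<notin> Range R"
        using word_orientation_source[of A w] w \<open>R \<noteq> {}\<close> by auto
      moreover obtain y where y: "y \<in> Range R" "y \<notin> Domain R"
        using word_orientation_sink[of w] w \<open>R \<noteq> {}\<close> by auto
      ultimately have "x \<in> S" "y \<in> S" by auto
      then have "x = v" "y = v" using x y eq by auto
      then show False using x y by simp
    qed
  qed auto
  have "(\<Sum>T\<in>?\<T>. (- 1) ^ card T * int (card (rooted_orientations A v (S - T)))) =
        (\<Sum>T\<in>?\<T>. \<Sum>R | R \<in> ?\<O> \<and> T \<inter> Range R = {} \<and> S - T - {v} \<subseteq> Domain R. (- 1) ^ card T)"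
    using assms by (intro sum.cong) (auto simp: card_orientations_with_sources[symmetric])
  also have "\<dots> = (\<Sum>R\<in>?\<O>. \<Sum>T | T \<in> ?\<T> \<and> T \<inter> Range R = {} \<and> S - T - {v} \<subseteq> Domain R. (- 1) ^ card T)"
    using fin(2,1) by (rule sum.swap_restrict)
  also have "\<dots> = (\<Sum>R\<in>?\<O>. \<Sum>T | ?C R \<subseteq> T \<and> T \<subseteq> ?D R. (- 1) ^ card T)"
    using between by (intro sum.cong) auto
  \<comment> \<open>For the empty orientation both ends of the interval are \<open>S - {v}\<close>,
    whence the exponent.\<close>
  also have "\<dots> = (\<Sum>R\<in>?\<O>. if R = {} then (- 1) ^ (card S - 1) else 0)"
  proof (rule sum.cong)
    fix R assume "R \<in> ?\<O>"
    have "(\<Sum>T | ?C R \<subseteq> T \<and> T \<subseteq> ?D R. (- 1) ^ card T) = (if ?C R = ?D R then (- 1) ^ card (?D R) else (0::int))"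
      using assms by (intro sum_signed_interval) auto
    then show "(\<Sum>T | ?C R \<subseteq> T \<and> T \<subseteq> ?D R. (- 1) ^ card T) = (if R = {} then (- 1) ^ (card S - 1) else (0::int))"
      using extremal[OF \<open>R \<in> ?\<O>\<close>] assms by auto
  qed simp
  also have "\<dots> = (if stable A S then (- 1) ^ (card S - 1) else 0)"
    using fin assms(1) by (simp add: empty_acyclic_orientation)
  finally show ?thesis .
qed

section \<open>Colourings as convolution powers of the indicator of stable sets\<close>

lemma finite_colourings: "finite S \<Longrightarrow> finite (colourings A S q)"
  unfolding colourings_def by (rule finite_subset[OF _ finite_PiE[of S "\<lambda>_. {..<q}"]]) auto

text \<open>The zeroth power is the unit of the convolution.\<close>

lemma card_colourings_0: "card (colourings A S 0) = (if S = {} then 1 else 0)"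
proof (cases "S = {}")
  case False
  then have "S \<rightarrow>\<^sub>E {..<0::nat} = {}" by (auto simp: PiE_eq_empty_iff)
  then show ?thesis using False by (simp add: colourings_def)
qed (simp add: colourings_def)

text \<open>U is the class of the last colour \<open>q\<close>; what remains is a colouring of the
  complement with one colour less. This multiplies by one more factor of the convolution.\<close>

lemma card_colourings_Suc:
  assumes "finite S"
  shows "card (colourings A S (Suc q)) = (\<Sum>U | U \<subseteq> S \<and> stable A U. card (colourings A (S - U) q))"
proof -
  let ?last = "\<lambda>c. {x \<in> S. c x = q}"
  let ?fib = "\<lambda>U. {c \<in> colourings A S (Suc q). ?last c = U}"
  have "card (colourings A S (Suc q)) = (\<Sum>U | U \<subseteq> S \<and> stable A U. card (?fib U))"
  proof -
    have "?last ` colourings A S (Suc q) \<subseteq> {U. U \<subseteq> S \<and> stable A U}"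
      unfolding colourings_def stable_def by clarsimp (metis (mono_tags, lifting))
    then show ?thesis
      using sum.group[of "colourings A S (Suc q)" "{U. U \<subseteq> S \<and> stable A U}" ?last "\<lambda>_. 1::nat"] assms
      by (simp add: finite_colourings)
  qed
  also have "\<dots> = (\<Sum>U | U \<subseteq> S \<and> stable A U. card (colourings A (S - U) q))"
  proof (rule sum.cong[OF HOL.refl])
    fix U assume "U \<in> {U. U \<subseteq> S \<and> stable A U}"
    then have U: "U \<subseteq> S" "stable A U" by auto
    let ?ext = "\<lambda>c x. if x \<in> U then q else c x"
    have "bij_betw (\<lambda>c. restrict c (S - U)) (?fib U) (colourings A (S - U) q)"
    proof (rule bij_betw_byWitness[where f' = ?ext])
      show "\<forall>c\<in>?fib U. ?ext (restrict c (S - U)) = c"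
        using U by (auto simp: colourings_def fun_eq_iff PiE_def extensional_def)
      show "\<forall>c\<in>colourings A (S - U) q. restrict (?ext c) (S - U) = c"
        by (auto simp: colourings_def fun_eq_iff PiE_def extensional_def)
      show "(\<lambda>c. restrict c (S - U)) ` ?fib U \<subseteq> colourings A (S - U) q"
      proof
        fix c' assume "c' \<in> (\<lambda>c. restrict c (S - U)) ` ?fib U"
        then obtain c where c: "c \<in> colourings A S (Suc q)" "?last c = U" "c' = restrict c (S - U)"
          by blast
        have "c x < q" if "x \<in> S - U" for x
          using c that by (force simp: colourings_def PiE_iff less_Suc_eq)
        then show "c' \<in> colourings A (S - U) q"
          using c by (auto simp: colourings_def)
      qed
      show "?ext ` colourings A (S - U) q \<subseteq> ?fib U"
      proof
        fix c' assume "c' \<in> ?ext ` colourings A (S - U) q"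
        then obtain c where c: "c \<in> colourings A (S - U) q" "c' = ?ext c" by blast
        have *: "c x < q" if "x \<in> S - U" for x
          using c that by (auto simp: colourings_def)
        have "c' \<in> S \<rightarrow>\<^sub>E {..<Suc q}"
          using c U * by (auto simp: colourings_def PiE_iff extensional_def less_Suc_eq)
        moreover have "c' x \<noteq> c' y" if "x \<in> S" "y \<in> S" "A x y" for x y
          using that c U *[of x] *[of y] by (auto simp: colourings_def stable_def)
        moreover have "?last c' = U" using c U * by auto
        ultimately show "c' \<in> ?fib U" by (simp add: colourings_def)
      qed
    qed
    then show "card (?fib U) = card (colourings A (S - U) q)" by (rule bij_betw_same_card)
  qed
  finally show ?thesis .
qed

end

text \<open>The recursion behind the exponential formula: a partition is its block through v
  together with a partition of the complement. Marking v singles out one block, so no division by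
  the number of blocks occurs.\<close>

lemma sum_partitions_block_containing:
  fixes g :: "'a set \<Rightarrow> 'c::comm_semiring_1"
  assumes "finite S" "v \<in> S"
  shows "(\<Sum>\<pi> | partition_on S \<pi>. \<Prod>T\<in>\<pi>. g T) =
         (\<Sum>T | v \<in> T \<and> T \<subseteq> S. g T * (\<Sum>\<pi> | partition_on (S - T) \<pi>. \<Prod>T\<in>\<pi>. g T))"
proof -
  let ?B = "{T. v \<in> T \<and> T \<subseteq> S}" and ?P = "\<lambda>T. {\<pi>. partition_on (S - T) \<pi>}"
  have disj: "disjnt T (\<Union>\<pi>)" "T \<notin> \<pi>" if "T \<in> ?B" "\<pi> \<in> ?P T" for T \<pi>
    using that by (auto simp: partition_on_def disjnt_def)
  have part: "partition_on S (insert T \<pi>)" if "T \<in> ?B" "\<pi> \<in> ?P T" for T \<pi>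
    using that partition_on_insert[OF disj(1)[OF that]] by auto
  \<comment> \<open>The blocks of a partition of \<open>S - T\<close> miss v, so T can be recovered
    as the block through v.\<close>
  have uniq: "T = T'" if "T \<in> ?B" "T' \<in> ?B" "\<pi> \<in> ?P T" "T' \<in> insert T \<pi>" for T T' \<pi>
    using that by (auto simp: partition_on_def)
  have bij: "bij_betw (\<lambda>(T, \<pi>). insert T \<pi>) (SIGMA T:?B. ?P T) {\<pi>. partition_on S \<pi>}"
    unfolding bij_betw_def
  proof
    show "inj_on (\<lambda>(T, \<pi>). insert T \<pi>) (SIGMA T:?B. ?P T)"
    proof (rule inj_onI, clarify)
      fix T \<pi> T' \<pi>'
      assume h: "v \<in> T" "T \<subseteq> S" "v \<in> T'" "T' \<subseteq> S" "partition_on (S - T) \<pi>" "partition_on (S - T') \<pi>'"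
        "insert T \<pi> = insert T' \<pi>'"
      have "T = T'" using h by (intro uniq[of T T' \<pi>]) auto
      then show "T = T' \<and> \<pi> = \<pi>'"
        using h disj(2)[of T \<pi>] disj(2)[of T' \<pi>'] by auto
    qed
    show "(\<lambda>(T, \<pi>). insert T \<pi>) ` (SIGMA T:?B. ?P T) = {\<pi>. partition_on S \<pi>}"
    proof
      show "(\<lambda>(T, \<pi>). insert T \<pi>) ` (SIGMA T:?B. ?P T) \<subseteq> {\<pi>. partition_on S \<pi>}"
        using part by auto
      show "{\<pi>. partition_on S \<pi>} \<subseteq> (\<lambda>(T, \<pi>). insert T \<pi>) ` (SIGMA T:?B. ?P T)"
      proof
        fix \<pi> assume "\<pi> \<in> {\<pi>. partition_on S \<pi>}"
        then have \<pi>: "partition_on S \<pi>" by simp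
        then obtain T where T: "T \<in> \<pi>" "v \<in> T"
          using assms(2) by (auto simp: partition_on_def)
        have "disjnt T (\<Union>(\<pi> - {T}))"
          using \<pi> T by (auto simp: partition_on_def disjoint_def disjnt_def)
        moreover have "insert T (\<pi> - {T}) = \<pi>" using T by auto
        ultimately have "partition_on (S - T) (\<pi> - {T})" "T \<subseteq> S"
          using \<pi> partition_on_insert[of T "\<pi> - {T}" S] by auto
        then show "\<pi> \<in> (\<lambda>(T, \<pi>). insert T \<pi>) ` (SIGMA T:?B. ?P T)"
          using T by (intro image_eqI[of _ _ "(T, \<pi> - {T})"]) auto
      qed
    qed
  qed
  have fin: "finite ?B" "\<And>T. finite (?P T)"
    using assms by (auto intro: finitely_many_partition_on)
  have "(\<Sum>\<pi> | partition_on S \<pi>. \<Prod>T\<in>\<pi>. g T) = (\<Sum>(T, \<pi>)\<in>(SIGMA T:?B. ?P T). \<Prod>T\<in>insert T \<pi>. g T)"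
    by (subst sum.reindex_bij_betw[OF bij, symmetric]) (simp add: case_prod_beta)
  also have "\<dots> = (\<Sum>(T, \<pi>)\<in>(SIGMA T:?B. ?P T). g T * (\<Prod>T\<in>\<pi>. g T))"
  proof (rule sum.cong[OF HOL.refl], clarify)
    fix T \<pi> assume h: "v \<in> T" "T \<subseteq> S" "partition_on (S - T) \<pi>"
    have "finite \<pi>" using h assms by (intro finite_elements[of "S - T"]) auto
    then show "(\<Prod>T\<in>insert T \<pi>. g T) = g T * (\<Prod>T\<in>\<pi>. g T)"
      using disj(2)[of T \<pi>] h by simp
  qed
  also have "\<dots> = (\<Sum>T\<in>?B. g T * (\<Sum>\<pi> \<in> ?P T. \<Prod>T\<in>\<pi>. g T))"
    using fin by (simp add: sum.Sigma[symmetric] sum_distrib_left)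
  finally show ?thesis .
qed

section \<open>Signed orientation counts as a logarithm\<close>

context adjacency
begin

context
  fixes V :: "'a set" and m :: "'a set \<Rightarrow> nat"
  assumes finite_V: "finite V"
    and m: "\<And>T v. T \<subseteq> V \<Longrightarrow> v \<in> T \<Longrightarrow> card (rooted_orientations A v T) = m T"
begin

abbreviation "signed_m T \<equiv> (- 1) ^ (card T - 1) * int (m T)"

text \<open>With \<open>W = U - T\<close> this is the signed count of rooted orientations multiplied
  by \<open>(- 1) ^ (card U - 1)\<close>. It reads as the logarithmic derivative at v: derivative of
  the logarithm, convolved with the indicator, gives the derivative of the indicator.\<close>

lemma sum_stable_complement:
  assumes "U \<subseteq> V" "v \<in> U"
  shows "(\<Sum>T | (v \<in> T \<and> T \<subseteq> U) \<and> stable A (U - T). signed_m T) = (if stable A U then 1 else 0)"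
proof -
  have fin: "finite U" using assms finite_V finite_subset by blast
  have "(\<Sum>T | (v \<in> T \<and> T \<subseteq> U) \<and> stable A (U - T). signed_m T) =
        (\<Sum>W | W \<subseteq> U - {v} \<and> stable A W.
           (- 1) ^ (card U - 1) * ((- 1) ^ card W * int (card (rooted_orientations A v (U - W)))))"
  proof (rule sum.reindex_bij_witness[where i = "\<lambda>W. U - W" and j = "\<lambda>T. U - T"])
    fix T assume "T \<in> {T. (v \<in> T \<and> T \<subseteq> U) \<and> stable A (U - T)}"
    then have T: "v \<in> T" "T \<subseteq> U" by auto
    then have "finite T" "T \<noteq> {}" using fin finite_subset by auto
    \<comment> \<open>Only parity matters: the signs of U and of the complement combine to the sign
      carried by T.\<close>
    then have c: "card U - 1 + card (U - T) = (card T - 1) + 2 * card (U - T)"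
      using T card_mono[OF fin T(2)] card_gt_0_iff[of T] by (simp add: card_Diff_subset)
    have "card (rooted_orientations A v (U - (U - T))) = m T"
      using m[of T v] T assms by (simp add: double_diff)
    moreover have "(- 1) ^ (card U - 1) * (- 1) ^ card (U - T) = ((- 1) ^ (card T - 1) :: int)"
      unfolding power_add[symmetric] c by (simp add: power_add power_mult)
    ultimately show "(- 1) ^ (card U - 1) * ((- 1) ^ card (U - T) *
        int (card (rooted_orientations A v (U - (U - T))))) = signed_m T"
      by (simp add: mult.assoc[symmetric])
  qed (use assms in \<open>auto simp: Diff_Diff_Int Int_absorb1 dest!: subset_Diff_insert[THEN iffD1]\<close>)
  also have "\<dots> = (if stable A U then 1 else 0)"
    using signed_rooted_orientations[OF fin assms(2)]
    by (simp add: sum_distrib_left[symmetric] power_add[symmetric] mult_2[symmetric])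
  finally show ?thesis .
qed

text \<open>
  With the convolution of set functions, the number of colourings is the \<open>q\<close>-th power of the indicator
  of stable sets, and the previous lemma says that the signed multiplicities are the logarithm of that
  indicator; this is the derivative of the power at \<open>v\<close>.
\<close>

lemma card_colourings_block_containing:
  assumes "S \<subseteq> V" "v \<in> S"
  shows "int (card (colourings A S q)) =
         int q * (\<Sum>T | v \<in> T \<and> T \<subseteq> S. signed_m T * int (card (colourings A (S - T) q)))"
  using assms
proof (induction q arbitrary: S)
  case 0
  then show ?case by (auto simp: card_colourings_0)
next
  case (Suc q)
  let ?P = "\<lambda>S q. int (card (colourings A S q))"
  have finS: "finite S" using Suc.prems finite_V finite_subset by blast
  let ?B = "{T. v \<in> T \<and> T \<subseteq> S}"
  let ?\<U> = "\<lambda>S. {U. U \<subseteq> S \<and> stable A U}"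
  have fin: "finite ?B" "\<And>S'. S' \<subseteq> S \<Longrightarrow> finite (?\<U> S')"
    using finS by (auto intro: finite_subset[OF _ finite_Pow_iff[THEN iffD2, OF finS]])
  have PSuc: "?P S' (Suc q) = (\<Sum>U\<in>?\<U> S'. ?P (S' - U) q)" if "S' \<subseteq> S" for S'
    using that finS finite_subset by (subst card_colourings_Suc) auto
  have split: "?\<U> S = {U \<in> ?\<U> S. v \<in> U} \<union> {U \<in> ?\<U> S. v \<notin> U}" by auto
  \<comment> \<open>One of the two halves of the Leibniz rule. If v lacks the last colour, the
    induction hypothesis applies to \<open>S - U\<close>; summing over U first restores the last
    colour on \<open>S - T\<close>.\<close>
  have avoid: "(\<Sum>U | U \<in> ?\<U> S \<and> v \<notin> U. ?P (S - U) q) =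
      int q * (\<Sum>T\<in>?B. signed_m T * ?P (S - T) (Suc q))"
  proof -
    have "(\<Sum>U | U \<in> ?\<U> S \<and> v \<notin> U. ?P (S - U) q) =
        (\<Sum>U | U \<in> ?\<U> S \<and> v \<notin> U. int q * (\<Sum>T | T \<in> ?B \<and> U \<inter> T = {}. signed_m T * ?P (S - U - T) q))"
    proof (rule sum.cong[OF HOL.refl])
      fix U assume U: "U \<in> {U. U \<in> ?\<U> S \<and> v \<notin> U}"
      then have "?P (S - U) q = int q * (\<Sum>T | v \<in> T \<and> T \<subseteq> S - U. signed_m T * ?P (S - U - T) q)"
        using Suc.prems by (intro Suc.IH) auto
      moreover have "{T. v \<in> T \<and> T \<subseteq> S - U} = {T \<in> ?B. U \<inter> T = {}}" by auto
      ultimately show "?P (S - U) q = int q * (\<Sum>T | T \<in> ?B \<and> U \<inter> T = {}. signed_m T * ?P (S - U - T) q)"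
        by simp
    qed
    also have "\<dots> = int q * (\<Sum>T\<in>?B. \<Sum>U | U \<in> {U. U \<in> ?\<U> S \<and> v \<notin> U} \<and> U \<inter> T = {}.
        signed_m T * ?P (S - U - T) q)"
      unfolding sum_distrib_left[of "int q", symmetric]
      by (subst sum.swap_restrict[OF _ fin(1)]) (auto intro: finite_subset[OF _ fin(2)[OF subset_refl]])
    also have "\<dots> = int q * (\<Sum>T\<in>?B. signed_m T * ?P (S - T) (Suc q))"
    proof (intro arg_cong[of _ _ "\<lambda>x. int q * x"] sum.cong[OF HOL.refl])
      fix T assume T: "T \<in> ?B"
      have "{U. U \<in> {U. U \<in> ?\<U> S \<and> v \<notin> U} \<and> U \<inter> T = {}} = ?\<U> (S - T)"
        using T by auto
      then show "(\<Sum>U | U \<in> {U. U \<in> ?\<U> S \<and> v \<notin> U} \<and> U \<inter> T = {}. signed_m T * ?P (S - U - T) q) =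
          signed_m T * ?P (S - T) (Suc q)"
        using PSuc[of "S - T"] by (simp add: sum_distrib_left Diff_Diff_Int Diff_eq Int_ac)
    qed
    finally show ?thesis .
  qed
  \<comment> \<open>The other half. If v has the last colour, the indicator of U is expanded by the
    logarithmic derivative, and \<open>U - T\<close> becomes the last colour class of
    \<open>S - T\<close>. The two halves contribute 1 and \<open>q\<close> times the same
    sum.\<close>
  have hit: "(\<Sum>U | U \<in> ?\<U> S \<and> v \<in> U. ?P (S - U) q) = (\<Sum>T\<in>?B. signed_m T * ?P (S - T) (Suc q))"
  proof -
    have "(\<Sum>U | U \<in> ?\<U> S \<and> v \<in> U. ?P (S - U) q) =
        (\<Sum>U\<in>?B. (if stable A U then 1 else 0) * ?P (S - U) q)"
      using fin by (intro sum.mono_neutral_cong_left) auto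
    also have "\<dots> = (\<Sum>U\<in>?B. \<Sum>T | T \<in> ?B \<and> (T \<subseteq> U \<and> stable A (U - T)). signed_m T * ?P (S - U) q)"
    proof (rule sum.cong[OF HOL.refl])
      fix U assume U: "U \<in> ?B"
      have eq: "{T. (v \<in> T \<and> T \<subseteq> U) \<and> stable A (U - T)} = {T \<in> ?B. T \<subseteq> U \<and> stable A (U - T)}"
        using U by auto
      have "(\<Sum>T | (v \<in> T \<and> T \<subseteq> U) \<and> stable A (U - T). signed_m T) = (if stable A U then 1 else 0)"
        using U Suc.prems by (intro sum_stable_complement) auto
      then show "(if stable A U then 1 else 0) * ?P (S - U) q =
          (\<Sum>T | T \<in> ?B \<and> (T \<subseteq> U \<and> stable A (U - T)). signed_m T * ?P (S - U) q)"
        by (simp only: eq sum_distrib_right[symmetric])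
    qed
    also have "\<dots> = (\<Sum>T\<in>?B. \<Sum>U | U \<in> ?B \<and> (T \<subseteq> U \<and> stable A (U - T)). signed_m T * ?P (S - U) q)"
      using fin(1,1) by (rule sum.swap_restrict)
    also have "\<dots> = (\<Sum>T\<in>?B. signed_m T * ?P (S - T) (Suc q))"
    proof (rule sum.cong[OF HOL.refl])
      fix T assume T: "T \<in> ?B"
      have "(\<Sum>U | U \<in> ?B \<and> (T \<subseteq> U \<and> stable A (U - T)). signed_m T * ?P (S - U) q) =
          (\<Sum>W\<in>?\<U> (S - T). signed_m T * ?P (S - T - W) q)"
        by (rule sum.reindex_bij_witness[where i = "\<lambda>W. T \<union> W" and j = "\<lambda>U. U - T"])
           (use T in \<open>auto simp: Un_Diff stable_def intro!: arg_cong[where f = "\<lambda>X. card (colourings A X q)"]\<close>)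
      then show "(\<Sum>U | U \<in> ?B \<and> (T \<subseteq> U \<and> stable A (U - T)). signed_m T * ?P (S - U) q) =
          signed_m T * ?P (S - T) (Suc q)"
        using PSuc[of "S - T"] by (simp add: sum_distrib_left)
    qed
    finally show ?thesis .
  qed
  have "?P S (Suc q) = (\<Sum>U | U \<in> ?\<U> S \<and> v \<in> U. ?P (S - U) q) + (\<Sum>U | U \<in> ?\<U> S \<and> v \<notin> U. ?P (S - U) q)"
    unfolding PSuc[OF subset_refl]
    by (subst split, subst sum.union_disjoint) (auto intro: finite_subset[OF _ fin(2)[OF subset_refl]])
  then show ?case
    unfolding hit avoid by (simp add: algebra_simps)
qed

text \<open>Both sides obey the same recursion over the block through a chosen vertex, with value 1
  on the empty set.\<close>

theorem card_colourings_partitions: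
  assumes "S \<subseteq> V"
  shows "int (card (colourings A S q)) = (\<Sum>\<pi> | partition_on S \<pi>. \<Prod>T\<in>\<pi>. int q * signed_m T)"
  using finite_subset[OF assms finite_V] assms
proof (induction S rule: finite_psubset_induct)
  case (psubset S)
  show ?case
  proof (cases "S = {}")
    case True
    then show ?thesis by (simp add: partition_on_empty colourings_def)
  next
    case False
    then obtain v where v: "v \<in> S" by blast
    have "int (card (colourings A S q)) =
        (\<Sum>T | v \<in> T \<and> T \<subseteq> S. int q * signed_m T * int (card (colourings A (S - T) q)))"
      using card_colourings_block_containing[OF psubset.prems v, of q]
      by (simp add: sum_distrib_left mult.assoc)
    also have "\<dots> = (\<Sum>T | v \<in> T \<and> T \<subseteq> S. int q * signed_m T *
        (\<Sum>\<pi> | partition_on (S - T) \<pi>. \<Prod>T\<in>\<pi>. int q * signed_m T))"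
    proof (rule sum.cong[OF HOL.refl])
      fix T assume "T \<in> {T. v \<in> T \<and> T \<subseteq> S}"
      then have "int (card (colourings A (S - T) q)) =
          (\<Sum>\<pi> | partition_on (S - T) \<pi>. \<Prod>T\<in>\<pi>. int q * signed_m T)"
        using psubset.prems by (intro psubset.IH) auto
      then show "int q * signed_m T * int (card (colourings A (S - T) q)) = int q * signed_m T *
        (\<Sum>\<pi> | partition_on (S - T) \<pi>. \<Prod>T\<in>\<pi>. int q * signed_m T)" by (simp only:)
    qed
    finally show ?thesis
      using sum_partitions_block_containing[OF psubset.hyps v, of "\<lambda>T. int q * signed_m T"] by (simp only:)
  qed
qed

end

end

section \<open>Lie algebras with Chevalley generators\<close>

context lie_algebra
begin

lemma bracket_zero_left [simp]: "bracket 0 x = 0"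
  using bracket_add_left[of 0 0 x] by simp

lemma bracket_zero_right [simp]: "bracket x 0 = 0"
  using bracket_add_right[of x 0 0] by simp

lemma bracket_minus_right: "bracket x (- y) = - bracket x y"
  using bracket_add_right[of x y "- y"] by (simp add: minus_unique)

lemma bracket_commute: "bracket x y = - bracket y x"
proof -
  have "bracket (x + y) (x + y) = 0" by (rule bracket_self)
  then have "bracket x y + bracket y x = 0"
    unfolding bracket_add_left bracket_add_right by (simp add: bracket_self add_ac)
  then show ?thesis by (simp add: eq_neg_iff_add_eq_0)
qed

lemma bracket_bracket_right:
  "bracket x (bracket y z) = bracket (bracket x y) z + bracket y (bracket x z)"
proof -
  have "bracket x (bracket y z) = - bracket y (bracket z x) - bracket z (bracket x y)"
    using jacobi[of x y z] by (simp add: algebra_simps eq_neg_iff_add_eq_0)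
  also have "bracket y (bracket z x) = - bracket y (bracket x z)"
    by (subst bracket_commute[of z x]) (rule bracket_minus_right)
  also have "bracket z (bracket x y) = - bracket (bracket x y) z"
    by (rule bracket_commute)
  finally show ?thesis by simp
qed

lemma bracket_bracket_left:
  "bracket (bracket x y) z = bracket x (bracket y z) - bracket y (bracket x z)"
  by (simp add: bracket_bracket_right[of x y z])

lemma bracket_sum_right: "bracket x (\<Sum>k\<in>K. y k) = (\<Sum>k\<in>K. bracket x (y k))"
  by (induction K rule: infinite_finite_induct) (auto simp: bracket_add_right)

lemma bracket_in_span:
  assumes "y \<in> span Y" "\<And>y. y \<in> Y \<Longrightarrow> bracket x y \<in> span Z"
  shows "bracket x y \<in> span Z"
  using assms(1)
  by (induction rule: span_induct_alt)
     (auto simp: span_zero bracket_add_right bracket_scale_right intro: span_add span_scale assms(2))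

section \<open>Rewriting of nested brackets\<close>

abbreviation nested_bracket :: "('i \<Rightarrow> 'g) \<Rightarrow> 'i list \<Rightarrow> 'g \<Rightarrow> 'g" where
  "nested_bracket e u \<equiv> foldr (\<lambda>i. bracket (e i)) u"

lemma nested_bracket_in_span:
  assumes "y \<in> span Y" "\<And>y. y \<in> Y \<Longrightarrow> nested_bracket e u y \<in> span Z"
  shows "nested_bracket e u y \<in> span Z"
proof -
  have add: "nested_bracket e u (x + z) = nested_bracket e u x + nested_bracket e u z" for x z
    by (induction u) (auto simp: bracket_add_right)
  have scale: "nested_bracket e u (scale c x) = scale c (nested_bracket e u x)" for c x
    by (induction u) (auto simp: bracket_scale_right)
  have zero: "nested_bracket e u 0 = 0"
    by (induction u) auto
  show ?thesis
    using assms(1)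
    by (induction rule: span_induct_alt)
       (auto simp: span_zero add scale zero intro: span_add span_scale assms(2))
qed

text \<open>The adjoint map turns a nested bracket into the same nested commutator of the operators
  ad e. Expanding it gives products of these operators in permuted order.\<close>

lemma bracket_nested_bracket_in_span:
  "bracket (nested_bracket e u (e x)) y \<in> span {nested_bracket e b y | b. mset b = mset (u @ [x])}"
proof (induction u arbitrary: y)
  case Nil
  then show ?case by (intro span_base) (auto intro!: exI[of _ "[x]"])
next
  case (Cons z u)
  let ?M = "nested_bracket e u (e x)"
  let ?Z = "{nested_bracket e b y | b. mset b = mset ((z # u) @ [x])}"
  have "bracket (e z) (bracket ?M y) \<in> span ?Z"
  proof (rule bracket_in_span[OF Cons.IH])
    fix w assume "w \<in> {nested_bracket e b y | b. mset b = mset (u @ [x])}"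
    then obtain b where "mset b = mset (u @ [x])" "w = nested_bracket e b y" by blast
    then show "bracket (e z) w \<in> span ?Z"
      by (intro span_base CollectI exI[of _ "z # b"]) simp
  qed
  moreover have "bracket ?M (bracket (e z) y) \<in> span ?Z"
  proof (rule subsetD[OF span_mono Cons.IH], clarify)
    fix b assume "mset b = mset (u @ [x])"
    then show "\<exists>b'. nested_bracket e b (bracket (e z) y) = nested_bracket e b' y \<and> mset b' = mset ((z # u) @ [x])"
      by (intro exI[of _ "b @ [z]"]) simp
  qed
  ultimately show ?case by (simp add: bracket_bracket_left span_diff)
qed

text \<open>In \<open>a @ v # b @ [x]\<close> the inner bracket of \<open>e v\<close> with the
  bracket over \<open>b @ [x]\<close> is turned around by antisymmetry, and the latter is then
  expanded as an operator applied to \<open>e v\<close>. Keeping the multiset of letters ensures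
  that orderings of a set remain orderings of that set.\<close>

lemma nested_bracket_change_last:
  assumes "v \<in> set (w @ [x])"
  shows "nested_bracket e w (e x) \<in> span {nested_bracket e u (e v) | u. mset (u @ [v]) = mset (w @ [x])}"
proof (cases "v = x")
  case True
  then show ?thesis by (intro span_base) auto
next
  case False
  let ?Z = "{nested_bracket e u (e v) | u. mset (u @ [v]) = mset (w @ [x])}"
  obtain a b where w: "w = a @ v # b"
    using assms False by (auto dest: split_list)
  have "- nested_bracket e a (bracket (nested_bracket e b (e x)) (e v)) \<in> span ?Z"
  proof (rule span_neg, rule nested_bracket_in_span[OF bracket_nested_bracket_in_span])
    fix y assume "y \<in> {nested_bracket e c (e v) | c. mset c = mset (b @ [x])}"
    then obtain c where "mset c = mset (b @ [x])" "y = nested_bracket e c (e v)" by blast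
    then show "nested_bracket e a y \<in> span ?Z"
      by (intro span_base CollectI exI[of _ "a @ c"]) (simp add: w)
  qed
  moreover have "- nested_bracket e a y = nested_bracket e a (- y)" for y
    by (induction a) (auto simp flip: bracket_minus_right)
  ultimately show ?thesis
    by (simp add: w bracket_commute[of "e v"])
qed

lemma nested_bracket_commute:
  assumes "\<And>a. a \<in> set u \<Longrightarrow> bracket (e a) (e x) = 0"
  shows "nested_bracket e u (bracket (e x) y) = bracket (e x) (nested_bracket e u y)"
  using assms
proof (induction u)
  case (Cons a u)
  then show ?case
    using bracket_bracket_right[of "e a" "e x" "nested_bracket e u y"] by simp
qed simp

lemma bracket_nested_bracket_eigen:
  assumes "\<And>i. i \<in> set (u @ [v]) \<Longrightarrow> \<exists>c. bracket k (e i) = scale c (e i)"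
  shows "\<exists>c. bracket k (nested_bracket e u (e v)) = scale c (nested_bracket e u (e v))"
  using assms
proof (induction u)
  case (Cons i u)
  obtain c d where "bracket k (e i) = scale c (e i)"
    "bracket k (nested_bracket e u (e v)) = scale d (nested_bracket e u (e v))"
    using Cons by fastforce
  then have "bracket k (nested_bracket e (i # u) (e v)) = scale (c + d) (nested_bracket e (i # u) (e v))"
    using bracket_bracket_right[of k "e i" "nested_bracket e u (e v)"]
    by (simp add: bracket_scale_left bracket_scale_right scale_left_distrib)
  then show ?case by blast
qed simp

text \<open>Half of the triangular decomposition: by the Leibniz rule, a generator of the opposite
  sign meets some \<open>e i\<close> and leaves an element of \<open>K\<close>, which acts
  diagonally. Stating it for an abstract family lets it serve for f acting on the e side and for e
  acting on the f side.\<close>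

lemma bracket_opposite_nested_bracket:
  assumes K: "\<And>i. i \<in> J \<Longrightarrow> bracket a (e i) \<in> K"
    and eigen: "\<And>k i. k \<in> K \<Longrightarrow> i \<in> J \<Longrightarrow> \<exists>c. bracket k (e i) = scale c (e i)"
    and "set (u @ [v]) \<subseteq> J"
  shows "bracket a (nested_bracket e u (e v)) \<in> span (K \<union> {nested_bracket e u (e v) | u v. set (u @ [v]) \<subseteq> J})"
    (is "_ \<in> span (K \<union> ?N)")
  using assms(3)
proof (induction u)
  case Nil
  then show ?case using K by (simp add: span_base)
next
  case (Cons i u)
  let ?M = "nested_bracket e u (e v)"
  have N: "nested_bracket e w (e x) \<in> span (K \<union> ?N)" if "set (w @ [x]) \<subseteq> J" for w x
    using that by (intro span_base) blast
  have "bracket (bracket a (e i)) ?M \<in> span (K \<union> ?N)"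
  proof -
    have "\<exists>c. bracket (bracket a (e i)) ?M = scale c ?M"
      by (intro bracket_nested_bracket_eigen eigen K) (use Cons.prems in auto)
    then obtain c where "bracket (bracket a (e i)) ?M = scale c ?M" ..
    then show ?thesis using N[of u v] Cons.prems by (simp add: span_scale)
  qed
  moreover have "bracket (e i) (bracket a ?M) \<in> span (K \<union> ?N)"
  proof (rule bracket_in_span)
    show "bracket a ?M \<in> span (K \<union> ?N)" using Cons by simp
    fix y assume "y \<in> K \<union> ?N"
    then show "bracket (e i) y \<in> span (K \<union> ?N)"
    proof
      assume "y \<in> K"
      then obtain c where "bracket y (e i) = scale c (e i)"
        using eigen[of y i] Cons.prems by auto
      then have "bracket (e i) y = - scale c (nested_bracket e [] (e i))"
        by (subst bracket_commute) simp
      then show ?thesis using N[of "[]" i] Cons.prems by (simp add: span_scale span_neg)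
    next
      assume "y \<in> ?N"
      then obtain w x where "y = nested_bracket e w (e x)" "set (w @ [x]) \<subseteq> J" by blast
      then show ?thesis using N[of "i # w" x] Cons.prems by simp
    qed
  qed
  ultimately show ?case
    using bracket_bracket_right[of a "e i" ?M] by (simp add: span_add)
qed

section \<open>Separation of weights\<close>

lemma root_space_subspace: "subspace (root_space scale bracket \<iota> \<gamma>)"
  by (rule subspaceI)
     (auto simp: root_space_def bracket_add_right bracket_scale_right scale_right_distrib mult.commute)

lemma bracket_root_space:
  assumes "x \<in> root_space scale bracket \<iota> \<gamma>" "y \<in> root_space scale bracket \<iota> \<delta>"
  shows "bracket x y \<in> root_space scale bracket \<iota> (\<gamma> + \<delta>)"
  unfolding root_space_def
proof (intro CollectI allI)
  fix h
  have "bracket (\<iota> h) x = scale (\<gamma> h) x" "bracket (\<iota> h) y = scale (\<delta> h) y"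
    using assms by (simp_all add: root_space_def)
  then show "bracket (\<iota> h) (bracket x y) = scale ((\<gamma> + \<delta>) h) (bracket x y)"
    using bracket_bracket_right[of "\<iota> h" x y]
    by (simp add: bracket_scale_left bracket_scale_right scale_left_distrib)
qed

lemma nested_bracket_root_space:
  assumes "\<And>i. i \<in> set (u @ [v]) \<Longrightarrow> e i \<in> root_space scale bracket \<iota> (\<gamma> i)"
  shows "nested_bracket e u (e v) \<in> root_space scale bracket \<iota> (\<Sum>i\<leftarrow>u @ [v]. \<gamma> i)"
  using assms by (induction u) (auto intro!: bracket_root_space)

lemma root_spaces_independent:
  assumes "finite \<Gamma>" "\<And>\<gamma>. \<gamma> \<in> \<Gamma> \<Longrightarrow> y \<gamma> \<in> root_space scale bracket \<iota> \<gamma>" "(\<Sum>\<gamma>\<in>\<Gamma>. y \<gamma>) = 0" "\<gamma> \<in> \<Gamma>"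
  shows "y \<gamma> = 0"
  using assms
proof (induction \<Gamma> arbitrary: y \<gamma> rule: finite_induct)
  case (insert \<delta> \<Gamma>)
  have zero: "y \<gamma> = 0" if "\<gamma> \<in> \<Gamma>" for \<gamma>
  proof -
    from that insert.hyps(2) have "\<gamma> \<noteq> \<delta>" by metis
    then obtain h where h: "\<gamma> h \<noteq> \<delta> h" by (meson ext)
    \<comment> \<open>Acting by a separating \<open>h\<close> and subtracting
      \<open>\<delta> h\<close> times the relation kills the term at \<open>\<delta>\<close>, which
      leaves a relation over the smaller set.\<close>
    let ?y = "\<lambda>\<gamma>. scale (\<gamma> h - \<delta> h) (y \<gamma>)"
    have "bracket (\<iota> h) (\<Sum>\<gamma>\<in>insert \<delta> \<Gamma>. y \<gamma>) = (\<Sum>\<gamma>\<in>insert \<delta> \<Gamma>. scale (\<gamma> h) (y \<gamma>))"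
    proof -
      have "bracket (\<iota> h) (\<Sum>\<gamma>\<in>insert \<delta> \<Gamma>. y \<gamma>) = (\<Sum>\<gamma>\<in>insert \<delta> \<Gamma>. bracket (\<iota> h) (y \<gamma>))"
        by (rule bracket_sum_right)
      also have "\<dots> = (\<Sum>\<gamma>\<in>insert \<delta> \<Gamma>. scale (\<gamma> h) (y \<gamma>))"
        using insert.prems(1) by (intro sum.cong) (auto simp: root_space_def)
      finally show ?thesis .
    qed
    then have "(\<Sum>\<gamma>\<in>insert \<delta> \<Gamma>. scale (\<gamma> h) (y \<gamma>)) - scale (\<delta> h) (\<Sum>\<gamma>\<in>insert \<delta> \<Gamma>. y \<gamma>) = 0"
      using insert.prems(2) by simp
    moreover have "(\<Sum>\<gamma>\<in>insert \<delta> \<Gamma>. ?y \<gamma>) =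
        (\<Sum>\<gamma>\<in>insert \<delta> \<Gamma>. scale (\<gamma> h) (y \<gamma>)) - scale (\<delta> h) (\<Sum>\<gamma>\<in>insert \<delta> \<Gamma>. y \<gamma>)"
      by (simp only: scale_left_diff_distrib sum_subtractf scale_sum_right)
    ultimately have "(\<Sum>\<gamma>\<in>\<Gamma>. ?y \<gamma>) = 0" using insert.hyps by simp
    moreover have "?y \<gamma>' \<in> root_space scale bracket \<iota> \<gamma>'" if "\<gamma>' \<in> \<Gamma>" for \<gamma>'
      by (rule subspace_scale[OF root_space_subspace]) (rule insert.prems(1), use that in simp)
    ultimately have "?y \<gamma> = 0" using that by (intro insert.IH[of ?y \<gamma>])
    then show ?thesis using h by simp
  qed
  have "y \<delta> + (\<Sum>\<gamma>\<in>\<Gamma>. y \<gamma>) = 0" using insert.prems(2) insert.hyps by simp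
  moreover have "(\<Sum>\<gamma>\<in>\<Gamma>. y \<gamma>) = 0" using zero by (rule sum.neutral[OF ballI])
  ultimately have "y \<delta> = 0" by simp
  then show ?case using zero[of \<gamma>] insert.prems(3) by (cases "\<gamma> = \<delta>") simp_all
qed simp

text \<open>An expansion of x into weight components must have all its weight in
  \<open>\<beta>\<close>, because root spaces are independent. This reduces a root space to the
  spanning vectors of that very weight.\<close>

lemma root_space_subset_span:
  assumes "\<And>\<gamma>. M \<gamma> \<subseteq> root_space scale bracket \<iota> \<gamma>" "x \<in> span (\<Union>\<gamma>. M \<gamma>)"
    "x \<in> root_space scale bracket \<iota> \<beta>"
  shows "x \<in> span (M \<beta>)"
proof -
  have "\<exists>\<Gamma> y. finite \<Gamma> \<and> (\<forall>\<gamma>. y \<gamma> \<in> span (M \<gamma>)) \<and> x = (\<Sum>\<gamma>\<in>\<Gamma>. y \<gamma>)"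
    using assms(2)
  proof (induction rule: span_induct_alt)
    case base
    show ?case by (rule exI[of _ "{}"], rule exI[of _ "\<lambda>_. 0"]) (simp add: span_zero)
  next
    case (step c m z)
    then obtain \<Gamma> y where y: "finite \<Gamma>" "\<And>\<gamma>. y \<gamma> \<in> span (M \<gamma>)" "z = (\<Sum>\<gamma>\<in>\<Gamma>. y \<gamma>)" by blast
    from step obtain \<delta> where \<delta>: "m \<in> M \<delta>" by blast
    let ?y = "\<lambda>\<gamma>. (if \<gamma> \<in> \<Gamma> then y \<gamma> else 0) + (if \<gamma> = \<delta> then scale c m else 0)"
    have "scale c m + z = (\<Sum>\<gamma>\<in>insert \<delta> \<Gamma>. ?y \<gamma>)"
    proof -
      have "(\<Sum>\<gamma>\<in>insert \<delta> \<Gamma>. if \<gamma> \<in> \<Gamma> then y \<gamma> else 0) = z"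
        unfolding y(3) by (rule sum.mono_neutral_cong_right) (use y(1) in auto)
      then show ?thesis using y(1) by (simp add: sum.distrib add.commute del: sum.insert)
    qed
    moreover have "?y \<gamma> \<in> span (M \<gamma>)" for \<gamma>
      by (rule span_add) (use y(2)[of \<gamma>] \<delta> in \<open>auto simp: span_zero span_scale span_base\<close>)
    ultimately show ?case
      using y(1) by (intro exI[of _ "insert \<delta> \<Gamma>"], intro exI[of _ ?y]) simp
  qed
  then obtain \<Gamma> y where y: "finite \<Gamma>" "\<And>\<gamma>. y \<gamma> \<in> span (M \<gamma>)" "x = (\<Sum>\<gamma>\<in>\<Gamma>. y \<gamma>)" by blast
  have yrs: "y \<gamma> \<in> root_space scale bracket \<iota> \<gamma>" for \<gamma>
    using y(2)[of \<gamma>] span_minimal[OF assms(1) root_space_subspace] by blast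
  \<comment> \<open>The relation expansion minus x, with x placed at \<open>\<beta>\<close>; the
    case distinctions also cover a \<open>\<beta>\<close> that does not occur in the
    expansion.\<close>
  let ?y = "\<lambda>\<gamma>. (if \<gamma> \<in> \<Gamma> then y \<gamma> else 0) - (if \<gamma> = \<beta> then x else 0)"
  have "?y \<beta> = 0"
  proof (rule root_spaces_independent[of "insert \<beta> \<Gamma>" ?y \<iota>])
    show "(\<Sum>\<gamma>\<in>insert \<beta> \<Gamma>. ?y \<gamma>) = 0"
    proof -
      have "(\<Sum>\<gamma>\<in>insert \<beta> \<Gamma>. if \<gamma> \<in> \<Gamma> then y \<gamma> else 0) = x"
        unfolding y(3) by (rule sum.mono_neutral_cong_right) (use y(1) in auto)
      then show ?thesis using y(1) by (simp add: sum_subtractf del: sum.insert)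
    qed
    show "?y \<gamma> \<in> root_space scale bracket \<iota> \<gamma>" for \<gamma>
      by (rule subspace_diff[OF root_space_subspace])
         (use yrs[of \<gamma>] assms(3) subspace_0[OF root_space_subspace, of \<iota> \<gamma>] in auto)
  qed (use y(1) in auto)
  then have "x = (if \<beta> \<in> \<Gamma> then y \<beta> else 0)" by simp
  then show ?thesis using y(2)[of \<beta>] by (auto simp: span_zero)
qed

end

section \<open>Root spaces of multiplicity-free roots\<close>

lemma sum_apply: "(\<Sum>k\<in>K. \<phi> k) x = (\<Sum>k\<in>K. \<phi> k x)"
  by (induction K rule: infinite_finite_induct) auto

lemma sum_list_apply: "(\<Sum>k\<leftarrow>w. \<phi> k) x = (\<Sum>k\<leftarrow>w. \<phi> k x)"
  by (induction w) auto

lemma filter_neq: "x \<notin> set w \<Longrightarrow> filter (\<lambda>y. y \<noteq> x) w = w"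
  by (induction w) auto

lemma distinct_if_count_list: "(\<And>i. count_list w i \<le> 1) \<Longrightarrow> distinct w"
proof (induction w)
  case (Cons x w)
  have "count_list w i \<le> 1" for i
    using Cons.prems[of i] by (cases "i = x") simp_all
  moreover have "x \<notin> set w"
    using Cons.prems[of x] by (simp add: count_list_0_iff)
  ultimately show ?case using Cons.IH by simp
qed simp

locale simply_laced_kac_moody_algebra =
  kac_moody_algebra scale_h I B simple_coroot simple_root scale bracket \<iota> e f + adjacency A
  for scale_h :: "complex \<Rightarrow> 'h::ab_group_add \<Rightarrow> 'h"
    and I :: "'a set"
    and B :: "'a \<Rightarrow> 'a \<Rightarrow> int"
    and simple_coroot :: "'a \<Rightarrow> 'h"
    and simple_root :: "'a \<Rightarrow> 'h \<Rightarrow> complex"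
    and scale :: "complex \<Rightarrow> 'g::ab_group_add \<Rightarrow> 'g"
    and bracket :: "'g \<Rightarrow> 'g \<Rightarrow> 'g"
    and \<iota> :: "'h \<Rightarrow> 'g"
    and e f :: "'a \<Rightarrow> 'g"
    and A :: "'a \<Rightarrow> 'a \<Rightarrow> bool" +
  assumes finite_I: "finite I"
    and B_eq: "\<And>i j. i \<in> I \<Longrightarrow> j \<in> I \<Longrightarrow> B i j = (if i = j then 2 else if A i j then - 1 else 0)"
begin

abbreviation "rs \<equiv> root_space scale bracket \<iota>"
abbreviation "relations \<equiv> km_relations scale_h I B simple_coroot simple_root"
abbreviation "ev \<equiv> lie_eval (case_km_gen \<iota> e f)"

lemma ev_surj: "\<exists>t. gens t \<subseteq> km_gens I \<and> ev t = y"
  using presentation by (simp add: presented_by_def)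

lemma ev_eq_iff:
  "gens s \<subseteq> km_gens I \<Longrightarrow> gens t \<subseteq> km_gens I \<Longrightarrow> ev s = ev t \<longleftrightarrow> lie_cong relations s t"
  using presentation by (simp add: presented_by_def)

lemma ev_relation:
  "(s, t) \<in> relations \<Longrightarrow> gens s \<subseteq> km_gens I \<Longrightarrow> gens t \<subseteq> km_gens I \<Longrightarrow> ev s = ev t"
  by (simp add: ev_eq_iff lie_cong.rel)

lemma iota_scale: "\<iota> (scale_h c x) = scale c (\<iota> x)"
  using ev_relation[OF km_relations.cartan_scale] by (simp add: km_gens_def)

lemma bracket_iota_iota: "bracket (\<iota> x) (\<iota> y) = 0"
  using ev_relation[OF km_relations.hh] by (simp add: km_gens_def)

lemma bracket_e_f: "i \<in> I \<Longrightarrow> bracket (e i) (f i) = \<iota> (simple_coroot i)"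
  using ev_relation[OF km_relations.ef] by (simp add: km_gens_def)

lemma bracket_e_f_ne: "i \<in> I \<Longrightarrow> j \<in> I \<Longrightarrow> i \<noteq> j \<Longrightarrow> bracket (e i) (f j) = 0"
  using ev_relation[OF km_relations.ef_ne] by (simp add: km_gens_def)

lemma bracket_iota_e: "i \<in> I \<Longrightarrow> bracket (\<iota> x) (e i) = scale (simple_root i x) (e i)"
  using ev_relation[OF km_relations.he] by (simp add: km_gens_def)

lemma bracket_iota_f: "i \<in> I \<Longrightarrow> bracket (\<iota> x) (f i) = scale (- simple_root i x) (f i)"
  using ev_relation[OF km_relations.hf] by (simp add: km_gens_def)

text \<open>For a zero Cartan entry the Serre exponent is 1, so the relation is plain
  commutation.\<close>

lemma bracket_e_e:
  assumes "i \<in> I" "j \<in> I" "i \<noteq> j" "\<not> A i j"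
  shows "bracket (e i) (e j) = 0"
  using ev_relation[OF km_relations.serre_e[of i I j B]] assms by (simp add: B_eq km_gens_def)

lemma iota_0 [simp]: "\<iota> 0 = 0"
  using iota_scale[of 0 0] by simp

lemma bracket_e_f_in_range: "i \<in> I \<Longrightarrow> j \<in> I \<Longrightarrow> bracket (e i) (f j) \<in> range \<iota>"
  by (cases "i = j") (auto simp: bracket_e_f bracket_e_f_ne intro: range_eqI[of _ _ 0])

lemma bracket_f_e_in_range: "i \<in> I \<Longrightarrow> j \<in> I \<Longrightarrow> bracket (f i) (e j) \<in> range \<iota>"
proof -
  assume "i \<in> I" "j \<in> I"
  then obtain x where "bracket (e j) (f i) = \<iota> x" using bracket_e_f_in_range by blast
  then have "bracket (f i) (e j) = \<iota> (scale_h (- 1) x)"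
    by (subst bracket_commute) (simp add: iota_scale del: H.scale_minus_left)
  then show ?thesis by blast
qed

lemma range_iota_eigen:
  assumes "k \<in> range \<iota>" "i \<in> I"
  shows "\<exists>c. bracket k (e i) = scale c (e i)" "\<exists>c. bracket k (f i) = scale c (f i)"
  using assms bracket_iota_e[of i] bracket_iota_f[of i] by blast+

lemma iota_rs: "\<iota> x \<in> rs 0"
  by (simp add: root_space_def bracket_iota_iota)

lemma e_rs: "i \<in> I \<Longrightarrow> e i \<in> rs (simple_root i)"
  by (simp add: root_space_def bracket_iota_e)

lemma f_rs: "i \<in> I \<Longrightarrow> f i \<in> rs (- simple_root i)"
  by (simp add: root_space_def bracket_iota_f)

text \<open>The spanning set of the triangular decomposition, sorted by weight. The condition on
  \<open>\<gamma>\<close> sits inside the set, so the family is indexed by all functions and its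
  union is the whole spanning set.\<close>

definition weight_vectors :: "('h \<Rightarrow> complex) \<Rightarrow> 'g set" where
  "weight_vectors \<gamma> =
     {x \<in> range \<iota>. \<gamma> = 0} \<union>
     {nested_bracket e u (e v) | u v. set (u @ [v]) \<subseteq> I \<and> \<gamma> = (\<Sum>i\<leftarrow>u @ [v]. simple_root i)} \<union>
     {nested_bracket f u (f v) | u v. set (u @ [v]) \<subseteq> I \<and> \<gamma> = (\<Sum>i\<leftarrow>u @ [v]. - simple_root i)}"

lemma weight_vectors_subset: "weight_vectors \<gamma> \<subseteq> rs \<gamma>"
proof -
  have "nested_bracket e u (e v) \<in> rs (\<Sum>i\<leftarrow>u @ [v]. simple_root i)" if "set (u @ [v]) \<subseteq> I" for u v
    using that e_rs by (intro nested_bracket_root_space) blast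
  moreover have "nested_bracket f u (f v) \<in> rs (\<Sum>i\<leftarrow>u @ [v]. - simple_root i)" if "set (u @ [v]) \<subseteq> I" for u v
    using that f_rs by (intro nested_bracket_root_space) blast
  ultimately show ?thesis using iota_rs unfolding weight_vectors_def by blast
qed

abbreviation "nested es \<equiv> {nested_bracket es u (es v) | u v. set (u @ [v]) \<subseteq> I}"

lemma Union_weight_vectors: "(\<Union>\<gamma>. weight_vectors \<gamma>) = range \<iota> \<union> nested e \<union> nested f" (is "?L = ?R")
proof
  show "?L \<subseteq> ?R"
  proof (rule UN_least)
    show "weight_vectors \<gamma> \<subseteq> ?R" for \<gamma>
      unfolding weight_vectors_def by (intro Un_mono) blast+
  qed
  have "\<iota> x \<in> weight_vectors 0" for x
    unfolding weight_vectors_def by simp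
  moreover have "nested_bracket e u (e v) \<in> weight_vectors (\<Sum>i\<leftarrow>u @ [v]. simple_root i)"
    if "set (u @ [v]) \<subseteq> I" for u v
    unfolding weight_vectors_def using that by (intro UnI1 UnI2 CollectI exI[of _ u] exI[of _ v]) simp
  moreover have "nested_bracket f u (f v) \<in> weight_vectors (\<Sum>i\<leftarrow>u @ [v]. - simple_root i)"
    if "set (u @ [v]) \<subseteq> I" for u v
    unfolding weight_vectors_def using that by (intro UnI2 CollectI exI[of _ u] exI[of _ v]) simp
  ultimately show "?R \<subseteq> ?L" by fast
qed

lemma bracket_Gen_in_span:
  assumes g: "g \<in> km_gens I" and y: "y \<in> range \<iota> \<union> nested e \<union> nested f"
  shows "bracket (ev (Gen g)) y \<in> span (range \<iota> \<union> nested e \<union> nested f)" (is "_ \<in> span ?P")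
proof (cases g)
  case (Cartan x)
  from y Union_weight_vectors obtain \<gamma> where "y \<in> rs \<gamma>"
    using weight_vectors_subset by blast
  then show ?thesis using Cartan y by (simp add: root_space_def span_scale span_base)
next
  case (ChevE i)
  then have i: "i \<in> I" using g by (auto simp: km_gens_def)
  from y consider "y \<in> range \<iota>" | "y \<in> nested e" | "y \<in> nested f" by blast
  then have "bracket (e i) y \<in> span ?P"
  proof cases
    case 1
    then obtain x where "y = \<iota> x" by blast
    then have "bracket (e i) y = - scale (simple_root i x) (nested_bracket e [] (e i))"
      using i bracket_commute[of "e i"] by (simp add: bracket_iota_e)
    moreover have "nested_bracket e [] (e i) \<in> nested e"
      using i by (intro CollectI exI[of _ "[]"]) auto
    then have "nested_bracket e [] (e i) \<in> span ?P" by (intro span_base) simp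
    ultimately show ?thesis by (simp only: span_neg span_scale)
  next
    case 2
    then obtain u v where uv: "y = nested_bracket e u (e v)" "set (u @ [v]) \<subseteq> I" by blast
    then have "bracket (e i) y \<in> nested e"
      using i by (intro CollectI exI[of _ "i # u"] exI[of _ v]) simp
    then show ?thesis by (intro span_base) simp
  next
    case 3
    then obtain u v where uv: "y = nested_bracket f u (f v)" "set (u @ [v]) \<subseteq> I" by blast
    have "bracket (e i) y \<in> span (range \<iota> \<union> nested f)"
      unfolding uv(1)
      by (rule bracket_opposite_nested_bracket[OF _ _ uv(2)])
         (use i bracket_e_f_in_range range_iota_eigen(2) in blast)+
    then show ?thesis using span_mono[of "range \<iota> \<union> nested f" ?P] by blast
  qed
  then show ?thesis using ChevE by simp
next
  case (ChevF i)
  then have i: "i \<in> I" using g by (auto simp: km_gens_def)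
  from y consider "y \<in> range \<iota>" | "y \<in> nested f" | "y \<in> nested e" by blast
  then have "bracket (f i) y \<in> span ?P"
  proof cases
    case 1
    then obtain x where "y = \<iota> x" by blast
    then have "bracket (f i) y = - scale (- simple_root i x) (nested_bracket f [] (f i))"
      using i bracket_commute[of "f i"] by (simp add: bracket_iota_f)
    moreover have "nested_bracket f [] (f i) \<in> nested f"
      using i by (intro CollectI exI[of _ "[]"]) auto
    then have "nested_bracket f [] (f i) \<in> span ?P" by (intro span_base) simp
    ultimately show ?thesis by (simp only: span_neg span_scale)
  next
    case 2
    then obtain u v where uv: "y = nested_bracket f u (f v)" "set (u @ [v]) \<subseteq> I" by blast
    then have "bracket (f i) y \<in> nested f"
      using i by (intro CollectI exI[of _ "i # u"] exI[of _ v]) simp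
    then show ?thesis by (intro span_base) simp
  next
    case 3
    then obtain u v where uv: "y = nested_bracket e u (e v)" "set (u @ [v]) \<subseteq> I" by blast
    have "bracket (f i) y \<in> span (range \<iota> \<union> nested e)"
      unfolding uv(1)
      by (rule bracket_opposite_nested_bracket[OF _ _ uv(2)])
         (use i bracket_f_e_in_range range_iota_eigen(1) in blast)+
    then show ?thesis using span_mono[of "range \<iota> \<union> nested e" ?P] by blast
  qed
  then show ?thesis using ChevF by simp
qed

lemma span_weight_vectors: "y \<in> span (\<Union>\<gamma>. weight_vectors \<gamma>)"
proof -
  define U where "U = span (range \<iota> \<union> nested e \<union> nested f)"
  have U: "0 \<in> U" "\<And>x y. x \<in> U \<Longrightarrow> y \<in> U \<Longrightarrow> x + y \<in> U" "\<And>x y. x \<in> U \<Longrightarrow> y \<in> U \<Longrightarrow> x - y \<in> U"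
    "\<And>c x. x \<in> U \<Longrightarrow> scale c x \<in> U"
    unfolding U_def by (rule span_zero span_add span_diff span_scale; assumption)+
  have base: "x \<in> U" if "x \<in> range \<iota> \<or> x \<in> nested e \<or> x \<in> nested f" for x
    unfolding U_def using that by (intro span_base) simp
  \<comment> \<open>The claim is strengthened by invariance of U under bracketing with the value of
    t. This is what the bracket case needs: the value of one factor lies in U and the other factor
    preserves U.\<close>
  have "ev t \<in> U \<and> (\<forall>y\<in>U. bracket (ev t) y \<in> U)" if "gens t \<subseteq> km_gens I" for t
    using that
  proof (induction t)
    case (Gen g)
    then have g: "g \<in> km_gens I" by simp
    have "ev (Gen g) \<in> U"
    proof (cases g)
      case (Cartan x)
      then show ?thesis by (intro base) simp
    next
      case (ChevE i)
      then have "nested_bracket e [] (e i) \<in> nested e"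
        using g by (intro CollectI exI[of _ "[]"]) (auto simp: km_gens_def)
      then show ?thesis using ChevE base[of "e i"] by simp
    next
      case (ChevF i)
      then have "nested_bracket f [] (f i) \<in> nested f"
        using g by (intro CollectI exI[of _ "[]"]) (auto simp: km_gens_def)
      then show ?thesis using ChevF base[of "f i"] by simp
    qed
    moreover have "bracket (ev (Gen g)) y \<in> U" if "y \<in> U" for y
      using that bracket_Gen_in_span[OF g] unfolding U_def by (rule bracket_in_span)
    ultimately show ?case by simp
  next
    case Zero
    then show ?case by (simp add: U)
  next
    case (Add s t)
    then show ?case by (simp add: U bracket_add_left)
  next
    case (Smul c s)
    then show ?case by (simp add: U bracket_scale_left)
  next
    case (Brk s t)
    then show ?case by (simp add: U bracket_bracket_left)
  qed
  then show ?thesis using ev_surj[of y] unfolding Union_weight_vectors U_def by blast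
qed

lemma rs_subset_span: "rs \<beta> \<subseteq> span (weight_vectors \<beta>)"
  using root_space_subset_span[of weight_vectors \<iota>] weight_vectors_subset span_weight_vectors by blast

lemma simple_roots_independent:
  assumes "\<And>h. (\<Sum>i\<in>I. c i * simple_root i h) = 0" "i \<in> I"
  shows "c i = 0"
proof -
  interpret D: vector_space "\<lambda>(c::complex) (\<phi> :: 'h \<Rightarrow> complex) x. c * \<phi> x"
    by unfold_locales (auto simp: fun_eq_iff algebra_simps)
  let ?c = "\<lambda>\<phi>. c (inv_into I simple_root \<phi>)"
  have "(\<Sum>\<phi>\<in>simple_root ` I. (\<lambda>x. ?c \<phi> * \<phi> x)) = (\<Sum>i\<in>I. (\<lambda>x. c i * simple_root i x))"
    using H.roots_independent(1) by (simp add: sum.reindex)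
  also have "\<dots> = 0"
    using assms(1) by (auto simp: fun_eq_iff sum_apply)
  finally have "?c (simple_root i) = 0"
    using D.independentD[OF H.roots_independent(2) _ subset_refl, of ?c "simple_root i"] assms(2) finite_I
    by auto
  then show ?thesis using H.roots_independent(1) assms(2) by simp
qed

subsection \<open>A lowest weight representation separating the monomials\<close>

text \<open>
  Words in \<open>I\<close> span the Verma module of lowest weight \<open>0\<close> of the algebra without Serre relations. Below
  is its dual, on which the algebra acts from the right. The Serre relations hold on the functions
  vanishing on the ideal generated by the Serre elements.
\<close>

definition root_or_0 :: "'a \<Rightarrow> 'h \<Rightarrow> complex" where
  "root_or_0 i x = (if i \<in> I then simple_root i x else 0)"

definition weight :: "'a list \<Rightarrow> 'h \<Rightarrow> complex" where
  "weight w x = (\<Sum>i\<leftarrow>w. root_or_0 i x)"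

text \<open>The value of \<phi> on f_k applied to a word. Moving f_k to the right past e_k produces
  minus the coroot h_k, which acts on the remaining word by its weight; f_k kills the empty word.
  Passing the functional along avoids linear combinations of words.\<close>

primrec lower :: "'a \<Rightarrow> 'a list \<Rightarrow> ('a list \<Rightarrow> complex) \<Rightarrow> complex" where
  "lower k [] \<phi> = 0"
| "lower k (i # w) \<phi> =
     lower k w (\<lambda>u. \<phi> (i # u)) - of_bool (i = k) * (weight w (simple_coroot k) * \<phi> w)"

primrec act_gen :: "('a, 'h) km_gen \<Rightarrow> ('a list \<Rightarrow> complex) \<Rightarrow> 'a list \<Rightarrow> complex" where
  "act_gen (Cartan x) = (\<lambda>\<phi> w. weight w x * \<phi> w)"
| "act_gen (ChevE i) = (\<lambda>\<phi> w. \<phi> (i # w))"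
| "act_gen (ChevF i) = (\<lambda>\<phi> w. lower i w \<phi>)"

text \<open>The order in the bracket case is that of a right action: acting by s and then by t
  evaluates \<phi> on the product s t.\<close>

primrec act :: "('a, 'h) km_gen lie_expr \<Rightarrow> ('a list \<Rightarrow> complex) \<Rightarrow> 'a list \<Rightarrow> complex" where
  "act (Gen g) = act_gen g"
| "act Zero = (\<lambda>\<phi> w. 0)"
| "act (Add s t) = (\<lambda>\<phi> w. act s \<phi> w + act t \<phi> w)"
| "act (Smul c s) = (\<lambda>\<phi> w. c * act s \<phi> w)"
| "act (Brk s t) = (\<lambda>\<phi> w. act t (act s \<phi>) w - act s (act t \<phi>) w)"

definition serre_dual :: "('a list \<Rightarrow> complex) set" where
  "serre_dual = {\<phi>.
     (\<forall>i\<in>I. \<forall>j\<in>I. \<forall>u w. i \<noteq> j \<longrightarrow> \<not> A i j \<longrightarrow> \<phi> (u @ i # j # w) = \<phi> (u @ j # i # w)) \<and>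
     (\<forall>i\<in>I. \<forall>j\<in>I. \<forall>u w. A i j \<longrightarrow>
        \<phi> (u @ i # i # j # w) - 2 * \<phi> (u @ i # j # i # w) + \<phi> (u @ j # i # i # w) = 0)}"

lemma serre_dual_commute:
  "\<phi> \<in> serre_dual \<Longrightarrow> i \<in> I \<Longrightarrow> j \<in> I \<Longrightarrow> i \<noteq> j \<Longrightarrow> \<not> A i j \<Longrightarrow>
   \<phi> (u @ i # j # w) = \<phi> (u @ j # i # w)"
  unfolding serre_dual_def by blast

lemma serre_dual_cubic:
  "\<phi> \<in> serre_dual \<Longrightarrow> i \<in> I \<Longrightarrow> j \<in> I \<Longrightarrow> A i j \<Longrightarrow>
   \<phi> (u @ i # i # j # w) - 2 * \<phi> (u @ i # j # i # w) + \<phi> (u @ j # i # i # w) = 0"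
  unfolding serre_dual_def by blast

lemma serre_dual_linear:
  assumes "\<phi> \<in> serre_dual" "\<psi> \<in> serre_dual"
  shows "(\<lambda>w. a * \<phi> w + b * \<psi> w) \<in> serre_dual"
  unfolding serre_dual_def
proof (intro CollectI conjI ballI allI impI)
  fix i j u w
  assume ij: "i \<in> I" "j \<in> I"
  show "a * \<phi> (u @ i # j # w) + b * \<psi> (u @ i # j # w) = a * \<phi> (u @ j # i # w) + b * \<psi> (u @ j # i # w)"
    if "i \<noteq> j" "\<not> A i j"
    using serre_dual_commute[OF assms(1) ij that] serre_dual_commute[OF assms(2) ij that] by simp
  show "a * \<phi> (u @ i # i # j # w) + b * \<psi> (u @ i # i # j # w) -
      2 * (a * \<phi> (u @ i # j # i # w) + b * \<psi> (u @ i # j # i # w)) +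
      (a * \<phi> (u @ j # i # i # w) + b * \<psi> (u @ j # i # i # w)) = 0" if "A i j"
  proof -
    have "a * (\<phi> (u @ i # i # j # w) - 2 * \<phi> (u @ i # j # i # w) + \<phi> (u @ j # i # i # w)) +
        b * (\<psi> (u @ i # i # j # w) - 2 * \<psi> (u @ i # j # i # w) + \<psi> (u @ j # i # i # w)) = 0"
      using serre_dual_cubic[OF assms(1) ij that] serre_dual_cubic[OF assms(2) ij that] by simp
    then show ?thesis by (simp add: algebra_simps)
  qed
qed

lemma serre_dual_Cons:
  assumes "\<phi> \<in> serre_dual"
  shows "(\<lambda>w. \<phi> (k # w)) \<in> serre_dual"
  unfolding serre_dual_def
proof (intro CollectI conjI ballI allI impI)
  fix i j u w
  assume ij: "i \<in> I" "j \<in> I"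
  show "\<phi> (k # u @ i # j # w) = \<phi> (k # u @ j # i # w)" if "i \<noteq> j" "\<not> A i j"
    using serre_dual_commute[OF assms ij that, of "k # u" w] by simp
  show "\<phi> (k # u @ i # i # j # w) - 2 * \<phi> (k # u @ i # j # i # w) + \<phi> (k # u @ j # i # i # w) = 0"
    if "A i j"
    using serre_dual_cubic[OF assms ij that, of "k # u" w] by simp
qed

lemma weight_simps [simp]:
  "weight [] x = 0" "weight (i # w) x = root_or_0 i x + weight w x"
  "weight (u @ w) x = weight u x + weight w x"
  by (simp_all add: weight_def)

text \<open>Linearity of a simple root is available for indices in I only. The value 0 elsewhere
  makes it unconditional, so words over the whole type are allowed.\<close>

lemma root_or_0_linear: "root_or_0 i (x + y) = root_or_0 i x + root_or_0 i y" "root_or_0 i (scale_h c x) = c * root_or_0 i x"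
proof -
  have "simple_root i (x + y) = simple_root i x + simple_root i y \<and> simple_root i (scale_h c x) = c * simple_root i x"
    if "i \<in> I"
  proof -
    interpret L: Vector_Spaces.linear scale_h "(*)" "simple_root i"
      using that by (rule H.root_linear)
    show ?thesis by (simp add: L.add L.scale)
  qed
  then show "root_or_0 i (x + y) = root_or_0 i x + root_or_0 i y" "root_or_0 i (scale_h c x) = c * root_or_0 i x"
    by (auto simp: root_or_0_def)
qed

lemma weight_linear: "weight w (x + y) = weight w x + weight w y" "weight w (scale_h c x) = c * weight w x"
  by (induction w) (simp_all add: root_or_0_linear algebra_simps)

lemma root_or_0_coroot: "i \<in> I \<Longrightarrow> k \<in> I \<Longrightarrow> root_or_0 i (simple_coroot k) = of_int (B k i)"
  by (simp add: root_or_0_def H.pairing)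

lemma lower_linear:
  "lower k w (\<lambda>u. a * \<phi> u + b * \<psi> u) = a * lower k w \<phi> + b * lower k w \<psi>"
  by (induction w arbitrary: \<phi> \<psi>) (simp_all add: algebra_simps)

text \<open>f_k lowers weights by the k-th simple root. The constant \<open>c\<close> collects the
  roots of the letters stripped off in the induction.\<close>

lemma lower_weight:
  "lower k w (\<lambda>u. (c + weight u x) * \<phi> u) = (c + weight w x - root_or_0 k x) * lower k w \<phi>"
proof (induction w arbitrary: \<phi> c)
  case (Cons i w)
  show ?case
    using Cons.IH[of "c + root_or_0 i x" "\<lambda>u. \<phi> (i # u)"]
    by (cases "i = k") (simp_all add: algebra_simps)
qed simp

lemma lower_diff_weight:
  "lower k w (\<lambda>u. \<phi> u - b * ((c + weight u x) * \<psi> u)) =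
   lower k w \<phi> - b * ((c + weight w x - root_or_0 k x) * lower k w \<psi>)"
  using lower_linear[of k w 1 \<phi> "- b" "\<lambda>u. (c + weight u x) * \<psi> u"] lower_weight[of k w c x \<psi>]
  by simp

text \<open>Composition reverses the order: this is \<phi> on f_b f_a e_k w, with e_k pulled to the
  left. The shift by \<open>root_or_0 a (simple_coroot b)\<close> appears because h_b is evaluated
  on f_a w.\<close>

lemma lower_lower_Cons:
  "lower a (k # w) (\<lambda>u. lower b u \<phi>) =
     lower a w (\<lambda>u. lower b u (\<lambda>u. \<phi> (k # u)))
     - of_bool (k = b) * ((weight w (simple_coroot b) - root_or_0 a (simple_coroot b)) * lower a w \<phi>)
     - of_bool (k = a) * (weight w (simple_coroot a) * lower b w \<phi>)"
  using lower_diff_weight[of a w "\<lambda>u. lower b u (\<lambda>u. \<phi> (k # u))" "of_bool (k = b)" 0 "simple_coroot b" \<phi>]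
  by simp

lemma lower_lower_lower_Cons:
  "lower c (k # w) (\<lambda>u. lower a u (\<lambda>u. lower b u \<phi>)) =
     lower c w (\<lambda>u. lower a u (\<lambda>u. lower b u (\<lambda>u. \<phi> (k # u))))
     - of_bool (k = b) * ((weight w (simple_coroot b) - root_or_0 c (simple_coroot b) - root_or_0 a (simple_coroot b)) *
         lower c w (\<lambda>u. lower a u \<phi>))
     - of_bool (k = a) * ((weight w (simple_coroot a) - root_or_0 c (simple_coroot a)) * lower c w (\<lambda>u. lower b u \<phi>))
     - of_bool (k = c) * (weight w (simple_coroot c) * lower a w (\<lambda>u. lower b u \<phi>))"
proof -
  let ?X = "\<lambda>u. lower a u (\<lambda>u. lower b u (\<lambda>u. \<phi> (k # u)))"
  let ?Y = "\<lambda>u. ?X u - of_bool (k = b) * ((- root_or_0 a (simple_coroot b) + weight u (simple_coroot b)) * lower a u \<phi>)"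
  have "lower c (k # w) (\<lambda>u. lower a u (\<lambda>u. lower b u \<phi>)) =
      lower c w (\<lambda>u. lower a (k # u) (\<lambda>u. lower b u \<phi>))
      - of_bool (k = c) * (weight w (simple_coroot c) * lower a w (\<lambda>u. lower b u \<phi>))"
    by (simp only: lower.simps)
  also have "(\<lambda>u. lower a (k # u) (\<lambda>u. lower b u \<phi>)) =
      (\<lambda>u. ?Y u - of_bool (k = a) * ((0 + weight u (simple_coroot a)) * lower b u \<phi>))"
    unfolding lower_lower_Cons by (simp add: algebra_simps)
  also have "lower c w \<dots> = lower c w ?Y
      - of_bool (k = a) * ((0 + weight w (simple_coroot a) - root_or_0 c (simple_coroot a)) * lower c w (\<lambda>u. lower b u \<phi>))"
    by (rule lower_diff_weight)
  also have "lower c w ?Y = lower c w ?X - of_bool (k = b) *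
      ((- root_or_0 a (simple_coroot b) + weight w (simple_coroot b) - root_or_0 c (simple_coroot b)) * lower c w (\<lambda>u. lower a u \<phi>))"
    by (rule lower_diff_weight)
  finally show ?thesis by (simp add: algebra_simps)
qed

text \<open>The commutator of f_i and f_j kills the empty word and commutes with every e_k, as the
  Cartan entries between i and j vanish; hence it is zero on all words. The f relations therefore
  hold for arbitrary \<phi>, unlike those for e.\<close>

lemma lower_commute:
  assumes "i \<in> I" "j \<in> I" "i \<noteq> j" "\<not> A i j"
  shows "lower i w (\<lambda>u. lower j u \<phi>) = lower j w (\<lambda>u. lower i u \<phi>)"
proof (induction w arbitrary: \<phi>)
  case (Cons k w)
  have "root_or_0 i (simple_coroot j) = 0" "root_or_0 j (simple_coroot i) = 0"
    using assms adj_sym[of j i] by (auto simp: root_or_0_coroot B_eq)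
  then show ?case
    using Cons.IH[of "\<lambda>u. \<phi> (k # u)"] unfolding lower_lower_Cons by simp
qed simp

text \<open>The same argument for the cubic Serre element in the f: the Cartan terms for
  \<open>k = i\<close> and \<open>k = j\<close> cancel by the entries 2, -1, -1.\<close>

lemma lower_cubic:
  assumes "i \<in> I" "j \<in> I" "A i j"
  shows "lower j w (\<lambda>u. lower i u (\<lambda>u. lower i u \<phi>)) - 2 * lower i w (\<lambda>u. lower j u (\<lambda>u. lower i u \<phi>)) +
    lower i w (\<lambda>u. lower i u (\<lambda>u. lower j u \<phi>)) = 0"
proof (induction w arbitrary: \<phi>)
  case (Cons k w)
  have "i \<noteq> j" using assms adj_irrefl by auto
  then have r: "root_or_0 i (simple_coroot j) = - 1" "root_or_0 j (simple_coroot i) = - 1"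
    "root_or_0 i (simple_coroot i) = 2"
    using assms adj_sym[of i j] by (auto simp: root_or_0_coroot B_eq)
  show ?case
    using Cons.IH[of "\<lambda>u. \<phi> (k # u)"] \<open>i \<noteq> j\<close> unfolding lower_lower_lower_Cons r
    by (cases "k = i"; cases "k = j") (simp_all add: algebra_simps)
qed simp

text \<open>f_k commutes with the commutator of e_i and e_j, which settles the empty prefix. A
  letter in front adds a weight times a value of \<phi>; the two weights agree because the letters
  do, the two values by \<open>serre_dual\<close>.\<close>

lemma lower_swap:
  assumes "\<phi> \<in> serre_dual" "i \<in> I" "j \<in> I" "i \<noteq> j" "\<not> A i j"
  shows "lower k (u @ i # j # w) \<phi> = lower k (u @ j # i # w) \<phi>"
  using assms(1)
proof (induction u arbitrary: \<phi>)
  case Nil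
  have "root_or_0 i (simple_coroot j) = 0" "root_or_0 j (simple_coroot i) = 0"
    using assms adj_sym[of j i] by (auto simp: root_or_0_coroot B_eq)
  moreover have "(\<lambda>u. \<phi> (i # j # u)) = (\<lambda>u. \<phi> (j # i # u))"
    using serre_dual_commute[OF Nil assms(2-5), of "[]"] by simp
  ultimately show ?case using assms(4) by (cases "i = k"; cases "j = k") simp_all
next
  case (Cons x u)
  show ?case
    using Cons.IH[OF serre_dual_Cons[OF Cons.prems, of x]] serre_dual_commute[OF Cons.prems assms(2-5), of u w]
    by (simp add: add_ac)
qed

lemma lower_cubic_word:
  assumes "\<phi> \<in> serre_dual" "i \<in> I" "j \<in> I" "A i j"
  shows "lower k (u @ i # i # j # w) \<phi> - 2 * lower k (u @ i # j # i # w) \<phi> + lower k (u @ j # i # i # w) \<phi> = 0"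
  using assms(1)
proof (induction u arbitrary: \<phi>)
  case Nil
  have "i \<noteq> j" using assms adj_irrefl by auto
  then have r: "root_or_0 i (simple_coroot j) = - 1" "root_or_0 j (simple_coroot i) = - 1"
    "root_or_0 i (simple_coroot i) = 2"
    using assms adj_sym[of i j] by (auto simp: root_or_0_coroot B_eq)
  have "(\<lambda>u. \<phi> (i # i # j # u)) = (\<lambda>u. 2 * \<phi> (i # j # i # u) + (- 1) * \<phi> (j # i # i # u))"
    using serre_dual_cubic[OF Nil assms(2-4), of "[]"] by (auto simp: fun_eq_iff algebra_simps)
  then have "lower k w (\<lambda>u. \<phi> (i # i # j # u)) =
      2 * lower k w (\<lambda>u. \<phi> (i # j # i # u)) + (- 1) * lower k w (\<lambda>u. \<phi> (j # i # i # u))"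
    by (simp only: lower_linear)
  then show ?case
    using \<open>i \<noteq> j\<close> r by (cases "k = i"; cases "k = j") (simp_all add: algebra_simps)
next
  case (Cons x u)
  have wt: "weight (u @ i # i # j # w) h = weight (u @ i # j # i # w) h"
    "weight (u @ j # i # i # w) h = weight (u @ i # j # i # w) h" for h
    by (simp_all add: add_ac)
  let ?m = "of_bool (x = k) * weight (u @ i # j # i # w) (simple_coroot k)"
  let ?\<psi> = "\<lambda>w. \<phi> (x # w)"
  have "lower k ((x # u) @ i # i # j # w) \<phi> - 2 * lower k ((x # u) @ i # j # i # w) \<phi> +
      lower k ((x # u) @ j # i # i # w) \<phi> =
      (lower k (u @ i # i # j # w) ?\<psi> - 2 * lower k (u @ i # j # i # w) ?\<psi> + lower k (u @ j # i # i # w) ?\<psi>) -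
      ?m * (\<phi> (u @ i # i # j # w) - 2 * \<phi> (u @ i # j # i # w) + \<phi> (u @ j # i # i # w))"
    unfolding append_Cons lower.simps wt by (simp only: algebra_simps)
  also have "\<dots> = 0"
    using Cons.IH[OF serre_dual_Cons[OF Cons.prems, of x]] serre_dual_cubic[OF Cons.prems assms(2-4)] by simp
  finally show ?case .
qed

lemma lower_serre_dual: "\<phi> \<in> serre_dual \<Longrightarrow> (\<lambda>w. lower k w \<phi>) \<in> serre_dual"
  using lower_swap lower_cubic_word unfolding serre_dual_def[of] by blast

lemma weight_serre_dual:
  assumes "\<phi> \<in> serre_dual"
  shows "(\<lambda>w. weight w x * \<phi> w) \<in> serre_dual"
  unfolding serre_dual_def
proof (intro CollectI conjI ballI allI impI)
  fix i j u w
  assume ij: "i \<in> I" "j \<in> I"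
  show "weight (u @ i # j # w) x * \<phi> (u @ i # j # w) = weight (u @ j # i # w) x * \<phi> (u @ j # i # w)"
    if "i \<noteq> j" "\<not> A i j"
    using serre_dual_commute[OF assms(1) ij that] by (simp add: add_ac)
  show "weight (u @ i # i # j # w) x * \<phi> (u @ i # i # j # w) -
      2 * (weight (u @ i # j # i # w) x * \<phi> (u @ i # j # i # w)) +
      weight (u @ j # i # i # w) x * \<phi> (u @ j # i # i # w) = 0" if "A i j"
  proof -
    have "weight (u @ i # i # j # w) x *
        (\<phi> (u @ i # i # j # w) - 2 * \<phi> (u @ i # j # i # w) + \<phi> (u @ j # i # i # w)) = 0"
      using serre_dual_cubic[OF assms(1) ij that] by simp
    then show ?thesis by (simp add: algebra_simps)
  qed
qed

section \<open>The action respects the presentation\<close>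

lemma act_linear:
  "act t (\<lambda>w. a * \<phi> w + b * \<psi> w) = (\<lambda>w. a * act t \<phi> w + b * act t \<psi> w)"
proof (induction t arbitrary: \<phi> \<psi>)
  case (Gen g)
  show ?case by (cases g) (simp_all add: lower_linear algebra_simps)
qed (simp_all add: algebra_simps)

lemma act_serre_dual: "\<phi> \<in> serre_dual \<Longrightarrow> act t \<phi> \<in> serre_dual"
proof (induction t arbitrary: \<phi>)
  case (Gen g)
  then show ?case by (cases g) (simp_all add: weight_serre_dual serre_dual_Cons lower_serre_dual)
next
  case Zero
  then show ?case by (simp add: serre_dual_def)
next
  case (Add s t)
  then show ?case using serre_dual_linear[of "act s \<phi>" "act t \<phi>" 1 1] by simp
next
  case (Smul c s)
  then show ?case using serre_dual_linear[of "act s \<phi>" "act s \<phi>" c 0] by simp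
next
  case (Brk s t)
  then show ?case using serre_dual_linear[of "act t (act s \<phi>)" "act s (act t \<phi>)" 1 "- 1"] by simp
qed

lemma act_relation:
  assumes "(s, t) \<in> relations" "\<phi> \<in> serre_dual"
  shows "act s \<phi> = act t \<phi>"
  using assms(1)
proof cases
  case (cartan_add x y)
  then show ?thesis by (simp add: weight_linear algebra_simps)
next
  case (cartan_scale c x)
  then show ?thesis by (simp add: weight_linear algebra_simps)
next
  case (hh x y)
  then show ?thesis by (simp add: algebra_simps)
next
  case (ef i)
  then show ?thesis by simp
next
  case (ef_ne i j)
  then show ?thesis by simp
next
  case (he i x)
  then show ?thesis by (simp add: root_or_0_def algebra_simps)
next
  case (hf i x)
  then show ?thesis using lower_weight[of i _ 0 x \<phi>] by (simp add: root_or_0_def left_diff_distrib)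
next
  case (serre_e i j)
  have "act s \<phi> w = 0" for w
  proof (cases "A i j")
    case True
    then have "s = Brk (\<e> i) (Brk (\<e> i) (\<e> j))"
      using serre_e by (simp add: B_eq numeral_2_eq_2)
    then show ?thesis
      using serre_e True serre_dual_cubic[OF assms(2), of i j "[]" w] by (simp add: algebra_simps)
  next
    case False
    then show ?thesis
      using serre_e serre_dual_commute[OF assms(2), of i j "[]" w] by (simp add: B_eq)
  qed
  then show ?thesis using serre_e by (simp add: fun_eq_iff)
next
  case (serre_f i j)
  have "act s \<phi> w = 0" for w
  proof (cases "A i j")
    case True
    then have s: "s = Brk (\<f> i) (Brk (\<f> i) (\<f> j))"
      using serre_f by (simp add: B_eq numeral_2_eq_2)
    have "act s \<phi> w = lower j w (\<lambda>u. lower i u (\<lambda>u. lower i u \<phi>)) - 2 * lower i w (\<lambda>u. lower j u (\<lambda>u. lower i u \<phi>)) +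
      lower i w (\<lambda>u. lower i u (\<lambda>u. lower j u \<phi>))"
      using lower_linear[of i w 1 "\<lambda>w. lower j w (\<lambda>u. lower i u \<phi>)" "- 1" "\<lambda>w. lower i w (\<lambda>u. lower j u \<phi>)"]
      by (simp add: s)
    then show ?thesis using serre_f True lower_cubic by simp
  next
    case False
    then show ?thesis
      using serre_f lower_commute[of i j w \<phi>] by (simp add: B_eq)
  qed
  then show ?thesis using serre_f by (simp add: fun_eq_iff)
qed

text \<open>The relations hold on \<open>serre_dual\<close> only. Congruence for brackets applies
  one factor after the other, so it depends on this space being invariant.\<close>

lemma act_lie_cong:
  assumes "lie_cong relations s t" "\<phi> \<in> serre_dual"
  shows "act s \<phi> = act t \<phi>"
proof -
  have add: "act t (\<lambda>w. \<phi> w + \<psi> w) = (\<lambda>w. act t \<phi> w + act t \<psi> w)"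
    and sub: "act t (\<lambda>w. \<phi> w - \<psi> w) = (\<lambda>w. act t \<phi> w - act t \<psi> w)"
    and scl: "act t (\<lambda>w. c * \<phi> w) = (\<lambda>w. c * act t \<phi> w)"
    and zero: "act t (\<lambda>w. 0) = (\<lambda>w. 0)" for t \<phi> \<psi> c
    using act_linear[of t 1 \<phi> 1 \<psi>] act_linear[of t 1 \<phi> "- 1" \<psi>] act_linear[of t c \<phi> 0 \<phi>]
      act_linear[of t 0 \<phi> 0 \<phi>] by simp_all
  show ?thesis
    using assms
  proof (induction arbitrary: \<phi> rule: lie_cong.induct)
    case (rel s t)
    then show ?case by (rule act_relation)
  next
    case (cong_Brk s s' t t')
    then show ?case by (simp add: act_serre_dual)
  qed (simp_all add: add sub scl zero fun_eq_iff algebra_simps)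
qed

text \<open>A linear functional on the abstract algebra is obtained by evaluating a chosen
  expression at the lowest weight vector. The choice is immaterial: expressions of equal value are
  congruent by the presentation, and congruent expressions act alike.\<close>

lemma matrix_coefficient:
  assumes "\<phi> \<in> serre_dual"
  obtains \<Lambda> where "Vector_Spaces.linear scale (*) \<Lambda>"
    "\<And>t. gens t \<subseteq> km_gens I \<Longrightarrow> \<Lambda> (ev t) = act t \<phi> []"
proof -
  define \<tau> where "\<tau> y = (SOME t. gens t \<subseteq> km_gens I \<and> ev t = y)" for y
  have \<tau>: "gens (\<tau> y) \<subseteq> km_gens I" "ev (\<tau> y) = y" for y
    using someI_ex[OF ev_surj[of y]] by (simp_all add: \<tau>_def)
  define \<Lambda> where "\<Lambda> y = act (\<tau> y) \<phi> []" for y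
  have ev: "\<Lambda> (ev t) = act t \<phi> []" if "gens t \<subseteq> km_gens I" for t
    using act_lie_cong[OF _ assms, of "\<tau> (ev t)" t] ev_eq_iff[of "\<tau> (ev t)" t] that \<tau> by (simp add: \<Lambda>_def)
  have "Vector_Spaces.linear scale (*) \<Lambda>"
  proof unfold_locales
    show "\<Lambda> (x + y) = \<Lambda> x + \<Lambda> y" for x y
      using ev[of "Add (\<tau> x) (\<tau> y)"] \<tau> by (simp add: \<Lambda>_def)
    show "\<Lambda> (scale c x) = c * \<Lambda> x" for c x
      using ev[of "Smul c (\<tau> x)"] \<tau> by (simp add: \<Lambda>_def)
  qed (simp_all add: algebra_simps)
  then show ?thesis using ev that by blast
qed

abbreviation "nested_expr u v \<equiv> foldr (\<lambda>i. Brk (\<e> i)) u (\<e> v)"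

lemma ev_nested_expr: "ev (nested_expr u v) = nested_bracket e u (e v)"
  by (induction u) simp_all

lemma gens_nested_expr: "set (u @ [v]) \<subseteq> I \<Longrightarrow> gens (nested_expr u v) \<subseteq> km_gens I"
  by (induction u) (auto simp: km_gens_def)

text \<open>
  Expanding a nested bracket into words, \<open>u @ [v]\<close> is the only one with \<open>v\<close> at the end.
\<close>

lemma act_nested_expr:
  assumes "\<And>a b. b \<noteq> [] \<Longrightarrow> \<phi> (a @ v # b) = 0"
  shows "act (nested_expr u v) \<phi> w = (if w = [] then \<phi> (u @ [v]) else 0)"
  using assms
proof (induction u arbitrary: \<phi> w)
  case Nil
  then show ?case using Nil[of w "[]"] by simp
next
  case (Cons i u)
  have "\<phi> (i # a @ v # b) = 0" if "b \<noteq> []" for a b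
    using Cons.prems[OF that, of "i # a"] by simp
  then have "act (nested_expr u v) (\<lambda>w. \<phi> (i # w)) w = (if w = [] then \<phi> (i # u @ [v]) else 0)"
    by (rule Cons.IH)
  moreover have "act (nested_expr u v) \<phi> (i # w) = 0"
    using Cons.IH[of \<phi> "i # w"] Cons.prems by simp
  ultimately show ?case by simp
qed

definition orientation_indicator :: "'a set \<Rightarrow> ('a \<times> 'a) set \<Rightarrow> 'a list \<Rightarrow> complex" where
  "orientation_indicator S R w = of_bool (distinct w \<and> set w = S \<and> word_orientation A w = R)"

text \<open>Swapping non-adjacent neighbouring letters preserves the orientation. Each word in a
  cubic relation repeats a letter, so the indicator vanishes on all three.\<close>

lemma orientation_indicator_serre_dual: "orientation_indicator S R \<in> serre_dual"
  unfolding serre_dual_def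
proof (intro CollectI conjI ballI allI impI)
  fix i j u w
  show "orientation_indicator S R (u @ i # j # w) = orientation_indicator S R (u @ j # i # w)"
    if "i \<noteq> j" "\<not> A i j"
  proof -
    have "\<not> A j i" using that adj_sym by blast
    then have "word_orientation A (u @ i # j # w) = word_orientation A (u @ j # i # w)"
      using that by (auto simp: word_orientation_append)
    moreover have "distinct (u @ i # j # w) = distinct (u @ j # i # w)"
      "set (u @ i # j # w) = set (u @ j # i # w)" by auto
    ultimately show ?thesis by (simp only: orientation_indicator_def)
  qed
  show "orientation_indicator S R (u @ i # i # j # w) - 2 * orientation_indicator S R (u @ i # j # i # w) +
      orientation_indicator S R (u @ j # i # i # w) = 0"
    by (simp add: orientation_indicator_def)
qed

lemma rooted_orientation_last:
  assumes "word_orientation A w \<in> rooted_orientations A v S" "distinct w" "set w = S" "v \<in> S"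
  obtains u where "w = u @ [v]"
proof -
  obtain u x where w: "w = u @ [x]" using assms(3,4) by (cases w rule: rev_cases) auto
  then have "x \<notin> Domain (word_orientation A w)" using last_not_in_Domain[of u x A] assms(2) by simp
  moreover have "S - {v} \<subseteq> Domain (word_orientation A w)"
    using assms(1) by (simp add: rooted_orientations_def)
  ultimately have "x = v" using assms(3) w by auto
  then show ?thesis using w that by blast
qed

text \<open>Letters that precede x in w but follow it in a word starting with x would orient an edge
  to x both ways. Hence they commute with e_x, which moves to the front of w, and the remaining
  words again have equal orientations.\<close>

lemma nested_bracket_orientation:
  assumes "distinct u" "distinct w" "set u = set w" "set u \<subseteq> I" "word_orientation A u = word_orientation A w"
  shows "nested_bracket e u y = nested_bracket e w y"
  using assms
proof (induction u arbitrary: w)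
  case (Cons x u)
  have "x \<in> set w" using Cons.prems(3) by auto
  then obtain a b where w: "w = a @ x # b" by (meson split_list)
  have comm: "bracket (e i) (e x) = 0" if "i \<in> set a" for i
  proof (rule bracket_e_e)
    show "i \<in> I" "x \<in> I" using that w Cons.prems(4) unfolding Cons.prems(3) by auto
    show "i \<noteq> x" using that w Cons.prems(2) by auto
    show "\<not> A i x"
    proof
      assume "A i x"
      then have "(i, x) \<in> word_orientation A w" using that w by (auto simp: word_orientation_append)
      moreover have "i \<in> set (x # u)" "i \<noteq> x"
        using that w Cons.prems(2) unfolding Cons.prems(3) by auto
      then have "(x, i) \<in> word_orientation A (x # u)"
        using adj_sym[OF \<open>A i x\<close>] by simp
      ultimately show False
        using word_orientation_antisym[OF Cons.prems(2)] Cons.prems(5) by blast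
    qed
  qed
  have f: "filter (\<lambda>y. y \<noteq> x) (x # u) = u" "filter (\<lambda>y. y \<noteq> x) w = a @ b"
    using Cons.prems(1,2) unfolding w by (simp_all add: filter_neq)
  have "nested_bracket e u y = nested_bracket e (a @ b) y"
  proof (rule Cons.IH)
    have "x \<notin> set u" "x \<notin> set (a @ b)" using Cons.prems(1,2) w by auto
    moreover have "insert x (set u) = insert x (set (a @ b))" using Cons.prems(3) w by simp
    ultimately show "set u = set (a @ b)" by (simp add: insert_ident)
    show "word_orientation A u = word_orientation A (a @ b)"
      using Cons.prems(5) word_orientation_filter[of A "\<lambda>y. y \<noteq> x" "x # u"]
        word_orientation_filter[of A "\<lambda>y. y \<noteq> x" w]
      unfolding f by (simp only:)
  qed (use Cons.prems(1,2,4) w in auto)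
  then show ?case using nested_bracket_commute[of a e x "nested_bracket e b y"] comm by (simp add: w)
qed simp

text \<open>A sink x other than v commutes with every later letter, including v. So e_x moves inward
  until it meets e_v and annihilates it.\<close>

lemma nested_bracket_not_rooted:
  assumes "distinct (u @ [v])" "set (u @ [v]) \<subseteq> I" "\<not> set u \<subseteq> Domain (word_orientation A (u @ [v]))"
  shows "nested_bracket e u (e v) = 0"
proof -
  obtain x where x: "x \<in> set u" "x \<notin> Domain (word_orientation A (u @ [v]))" using assms(3) by blast
  then obtain a b where u: "u = a @ x # b" by (meson split_list)
  have comm: "bracket (e i) (e x) = 0" if "i \<in> set b \<union> {v}" for i
  proof (rule bracket_e_e)
    show "i \<in> I" "x \<in> I" "i \<noteq> x" using that u assms(1,2) by auto
    show "\<not> A i x"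
      using that u x(2) adj_sym[of i x] by (auto simp: word_orientation_append)
  qed
  have "bracket (e x) (nested_bracket e b (e v)) = nested_bracket e b (bracket (e x) (e v))"
    using nested_bracket_commute[of b e x "e v"] comm by simp
  also have "bracket (e x) (e v) = 0" using comm[of v] bracket_commute[of "e x" "e v"] by simp
  finally have "bracket (e x) (nested_bracket e b (e v)) = nested_bracket e b 0" .
  moreover have "nested_bracket e c 0 = 0" for c by (induction c) simp_all
  ultimately show ?thesis by (simp add: u)
qed

lemma sum_list_simple_root:
  "set w \<subseteq> I \<Longrightarrow> (\<Sum>i\<leftarrow>w. simple_root i h) = (\<Sum>i\<in>I. of_nat (count_list w i) * simple_root i h)"
proof (induction w)
  case (Cons x w)
  have "(\<Sum>i\<in>I. of_nat (count_list (x # w) i) * simple_root i h) =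
      (\<Sum>i\<in>I. (if i = x then simple_root i h else 0) + of_nat (count_list w i) * simple_root i h)"
    by (intro sum.cong) (auto simp: algebra_simps)
  also have "\<dots> = simple_root x h + (\<Sum>i\<in>I. of_nat (count_list w i) * simple_root i h)"
    using Cons.prems finite_I by (simp add: sum.distrib)
  finally show ?case using Cons by simp
qed simp

text \<open>Independence of the simple roots lets coefficients be compared: each letter of S occurs
  once and no other letter occurs. For the Cartan part and the f part, a coefficient at some
  \<open>j\<close> in S would have to be both positive and at most zero.\<close>

lemma weight_vectors_multiplicity_free:
  assumes S: "S \<subseteq> I" "S \<noteq> {}"
  shows "weight_vectors (\<Sum>i\<in>S. simple_root i) \<subseteq>
    {nested_bracket e u (e v) | u v. distinct (u @ [v]) \<and> set (u @ [v]) = S}"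
proof -
  let ?\<beta> = "\<Sum>i\<in>S. simple_root i"
  have \<beta>: "?\<beta> h = (\<Sum>i\<in>I. of_bool (i \<in> S) * simple_root i h)" for h
    using S(1) finite_I by (simp add: sum_apply of_bool_def if_distrib[of "\<lambda>c. c * _"] sum.If_cases Int_absorb1 cong: if_cong)
  obtain j where j: "j \<in> S" "j \<in> I" using S by blast
  have "?\<beta> \<noteq> 0"
  proof
    assume "?\<beta> = 0"
    then have "(\<Sum>i\<in>I. of_bool (i \<in> S) * simple_root i h) = 0" for h using \<beta>[of h] by simp
    then have "of_bool (j \<in> S) = (0::complex)" using j(2) by (rule simple_roots_independent)
    then show False using j by simp
  qed
  moreover have "distinct w \<and> set w = S" if w: "set w \<subseteq> I" "?\<beta> = (\<Sum>i\<leftarrow>w. simple_root i)" for w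
  proof -
    have "(\<Sum>i\<in>I. (of_nat (count_list w i) - of_bool (i \<in> S)) * simple_root i h) = 0" for h
      using fun_cong[OF w(2), of h] \<beta>[of h] sum_list_simple_root[OF w(1), of h]
      by (simp add: sum_list_apply left_diff_distrib sum_subtractf)
    then have "of_nat (count_list w i) - of_bool (i \<in> S) = (0::complex)" if "i \<in> I" for i
      using that by (rule simple_roots_independent)
    then have "of_nat (count_list w i) = (of_nat (of_bool (i \<in> S)) :: complex)" if "i \<in> I" for i
      using that by simp
    then have "count_list w i = of_bool (i \<in> S)" if "i \<in> I" for i
      using that by (simp only: of_nat_eq_iff)
    then have c: "count_list w i = of_bool (i \<in> S)" for i
      using w(1) S(1) by (cases "i \<in> I") (auto simp: count_list_0_iff)
    have "i \<in> set w \<longleftrightarrow> i \<in> S" for i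
      using c[of i] count_list_0_iff[of w i] by (cases "i \<in> S") simp_all
    moreover have "distinct w"
      using c by (intro distinct_if_count_list) simp
    ultimately show ?thesis by blast
  qed
  moreover have False if w: "set w \<subseteq> I" "?\<beta> = (\<Sum>i\<leftarrow>w. - simple_root i)" for w
  proof -
    have neg: "(\<Sum>i\<leftarrow>w. - simple_root i h) = - (\<Sum>i\<leftarrow>w. simple_root i h)" for h
      by (induction w) simp_all
    have "(\<Sum>i\<in>I. (of_nat (count_list w i) + of_bool (i \<in> S)) * simple_root i h) = 0" for h
    proof -
      have "?\<beta> h = - (\<Sum>i\<in>I. of_nat (count_list w i) * simple_root i h)"
        using w by (simp add: sum_list_apply neg sum_list_simple_root)
      then show ?thesis using \<beta>[of h] by (simp add: distrib_right sum.distrib)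
    qed
    then have "of_nat (count_list w j) + of_bool (j \<in> S) = (0::complex)"
      using j(2) by (rule simple_roots_independent)
    then have "of_nat (Suc (count_list w j)) = (0::complex)" using j(1) by (simp add: add.commute)
    then show False using of_nat_neq_0 by blast
  qed
  ultimately show ?thesis unfolding weight_vectors_def by blast
qed

theorem root_mult_eq_card_rooted_orientations:
  assumes S: "S \<subseteq> I" and v: "v \<in> S"
  shows "root_mult scale bracket \<iota> (\<Sum>i\<in>S. simple_root i) = card (rooted_orientations A v S)"
proof -
  let ?\<beta> = "\<Sum>i\<in>S. simple_root i" and ?\<R> = "rooted_orientations A v S"
  have "\<exists>u. distinct (u @ [v]) \<and> set (u @ [v]) = S \<and> word_orientation A (u @ [v]) = R" if R: "R \<in> ?\<R>" for R
  proof -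
    have "R \<in> acyclic_orientations A S" using R by (simp add: rooted_orientations_def)
    then obtain w where "distinct w" "set w = S" "R = word_orientation A w"
      by (rule acyclic_orientationE)
    then show ?thesis using rooted_orientation_last[of w v S] R v by metis
  qed
  then obtain r where r: "\<And>R. R \<in> ?\<R> \<Longrightarrow> distinct (r R @ [v])" "\<And>R. R \<in> ?\<R> \<Longrightarrow> set (r R @ [v]) = S"
    "\<And>R. R \<in> ?\<R> \<Longrightarrow> word_orientation A (r R @ [v]) = R"
    by metis
  define x where "x R = nested_bracket e (r R) (e v)" for R
  \<comment> \<open>A dual family for the brackets \<open>x R\<close>; injectivity and linear
    independence both follow from it.\<close>
  have coeff: "\<exists>\<Lambda>. Vector_Spaces.linear scale (*) \<Lambda> \<and> (\<forall>R'\<in>?\<R>. \<Lambda> (x R') = of_bool (R' = R))"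
    if R: "R \<in> ?\<R>" for R
  proof -
    obtain \<Lambda> where \<Lambda>: "Vector_Spaces.linear scale (*) \<Lambda>"
      "\<And>t. gens t \<subseteq> km_gens I \<Longrightarrow> \<Lambda> (ev t) = act t (orientation_indicator S R) []"
      using matrix_coefficient[OF orientation_indicator_serre_dual] by metis
    \<comment> \<open>The last letter of a word is always a sink, so the indicator of an orientation
      with only sink v lives on words ending in v. Words with v elsewhere therefore contribute
      nothing to a matrix coefficient.\<close>
    have ends: "orientation_indicator S R (a @ v # b) = 0" if "b \<noteq> []" for a b
    proof (rule ccontr)
      assume "orientation_indicator S R (a @ v # b) \<noteq> 0"
      then have h: "distinct (a @ v # b)" "set (a @ v # b) = S" "word_orientation A (a @ v # b) = R"
        by (auto simp: orientation_indicator_def)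
      then obtain u where "a @ v # b = u @ [v]"
        using rooted_orientation_last[of "a @ v # b" v S] R v by metis
      then show False using h(1) that
        by (metis append_butlast_last_id distinct.simps(2) distinct_append last.simps last_appendR last_in_set last_snoc list.distinct(1))
    qed
    have "\<Lambda> (x R') = of_bool (R' = R)" if R': "R' \<in> ?\<R>" for R'
    proof -
      have "gens (nested_expr (r R') v) \<subseteq> km_gens I"
        using r(2)[OF R'] S by (intro gens_nested_expr) simp
      then have "\<Lambda> (x R') = act (nested_expr (r R') v) (orientation_indicator S R) []"
        unfolding x_def ev_nested_expr[symmetric] by (rule \<Lambda>(2))
      also have "\<dots> = orientation_indicator S R (r R' @ [v])"
        using act_nested_expr[of "orientation_indicator S R" v "r R'" "[]"] ends by simp
      finally show ?thesis
        by (simp only: orientation_indicator_def r[OF R'] simp_thms)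
    qed
    then show ?thesis using \<Lambda>(1) by blast
  qed
  have inj: "inj_on x ?\<R>"
  proof (rule inj_onI)
    fix R R' assume h: "R \<in> ?\<R>" "R' \<in> ?\<R>" "x R = x R'"
    obtain \<Lambda> where "\<forall>R'\<in>?\<R>. \<Lambda> (x R') = (of_bool (R' = R) :: complex)" using coeff[OF h(1)] by blast
    then show "R = R'" using h by (metis of_bool_eq(1) of_bool_eq(2) zero_neq_one)
  qed
  have fin: "finite ?\<R>" using S finite_I finite_subset finite_rooted_orientations by metis
  have indep: "independent (x ` ?\<R>)"
  proof (rule independent_if_scalars_zero)
    show "finite (x ` ?\<R>)" using fin by simp
    fix c y assume c: "(\<Sum>y\<in>x ` ?\<R>. scale (c y) y) = 0" and "y \<in> x ` ?\<R>"
    then obtain R where R: "R \<in> ?\<R>" "y = x R" by blast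
    obtain \<Lambda> where \<Lambda>: "Vector_Spaces.linear scale (*) \<Lambda>" "\<forall>R'\<in>?\<R>. \<Lambda> (x R') = (of_bool (R' = R) :: complex)"
      using coeff[OF R(1)] by blast
    interpret \<Lambda>: Vector_Spaces.linear scale "(*)" \<Lambda> by fact
    have "0 = \<Lambda> (\<Sum>R'\<in>?\<R>. scale (c (x R')) (x R'))"
      using c inj by (simp add: sum.reindex)
    also have "\<dots> = (\<Sum>R'\<in>?\<R>. if R' = R then c (x R') else 0)"
      unfolding \<Lambda>.sum \<Lambda>.scale using \<Lambda>(2) by (intro sum.cong) auto
    also have "\<dots> = c y" using R fin by simp
    finally show "c y = 0" by simp
  qed
  have span: "rs ?\<beta> \<subseteq> span (x ` ?\<R>)"
  proof -
    have last_v: "nested_bracket e u (e v) \<in> span (x ` ?\<R>)" if u: "distinct (u @ [v])" "set (u @ [v]) = S" for u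
    proof (cases "set u \<subseteq> Domain (word_orientation A (u @ [v]))")
      case True
      let ?R = "word_orientation A (u @ [v])"
      have R: "?R \<in> ?\<R>"
        using u True by (auto simp: rooted_orientations_def acyclic_orientations_def)
      have "word_orientation A u = word_orientation A (r ?R)"
      proof -
        have f: "filter (\<lambda>y. y \<noteq> v) (u @ [v]) = u" "filter (\<lambda>y. y \<noteq> v) (r ?R @ [v]) = r ?R"
          using u(1) r(1)[OF R] by (simp_all add: filter_neq)
        show ?thesis
          using word_orientation_filter[of A "\<lambda>y. y \<noteq> v" "u @ [v]"]
            word_orientation_filter[of A "\<lambda>y. y \<noteq> v" "r ?R @ [v]"] r(3)[OF R]
          unfolding f by (simp only:)
      qed
      moreover have "set u = set (r ?R)" using u r(1,2)[OF R] by auto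
      ultimately have "nested_bracket e u (e v) = x ?R"
        unfolding x_def using u r(1)[OF R] S by (intro nested_bracket_orientation) auto
      then show ?thesis using R by (simp add: span_base)
    next
      case False
      then have "nested_bracket e u (e v) = 0" using u S by (intro nested_bracket_not_rooted) auto
      then show ?thesis by (simp add: span_zero)
    qed
    have "nested_bracket e w (e z) \<in> span (x ` ?\<R>)" if w: "distinct (w @ [z])" "set (w @ [z]) = S" for w z
    proof -
      have "nested_bracket e w (e z) \<in> span {nested_bracket e u (e v) | u. mset (u @ [v]) = mset (w @ [z])}"
        using v w by (intro nested_bracket_change_last) simp
      also have "\<dots> \<subseteq> span (span (x ` ?\<R>))"
      proof (rule span_mono, clarify)
        fix u assume "mset (u @ [v]) = mset (w @ [z])"
        then have "distinct (u @ [v])" "set (u @ [v]) = S"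
          using w mset_eq_imp_distinct_iff mset_eq_setD by metis+
        then show "nested_bracket e u (e v) \<in> span (x ` ?\<R>)" by (rule last_v)
      qed
      finally show ?thesis by (simp add: span_span)
    qed
    then have "weight_vectors ?\<beta> \<subseteq> span (x ` ?\<R>)"
      using weight_vectors_multiplicity_free[OF S] v by blast
    then have "span (weight_vectors ?\<beta>) \<subseteq> span (x ` ?\<R>)" by (rule span_minimal) simp
    then show ?thesis using rs_subset_span by blast
  qed
  have "x ` ?\<R> \<subseteq> rs ?\<beta>"
  proof clarify
    fix R assume R: "R \<in> ?\<R>"
    have "x R \<in> rs (\<Sum>i\<leftarrow>r R @ [v]. simple_root i)"
      unfolding x_def using r(2)[OF R] S by (intro nested_bracket_root_space e_rs) blast
    then show "x R \<in> rs ?\<beta>"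
      using sum_list_distinct_conv_sum_set[OF r(1)[OF R], of simple_root] r(2)[OF R] by simp
  qed
  then have "dim (rs ?\<beta>) = card (x ` ?\<R>)"
    using span indep by (intro dim_unique) auto
  then show ?thesis using inj by (simp add: root_mult_def card_image)
qed

end

section \<open>Chromatic polynomials\<close>

text \<open>Following arcs forward can stop only at the sink v. In the induction the first letter
  may be dropped since no arc ends there, so the remaining vertices keep their outgoing
  arcs.\<close>

lemma word_orientation_reaches_root:
  assumes "distinct w" "set w - {v} \<subseteq> Domain (word_orientation A w)" "v \<in> set w" "x \<in> set w"
  shows "(x, v) \<in> (word_orientation A w)\<^sup>*"
  using assms
proof (induction w arbitrary: x)
  case (Cons y w)
  show ?case
  proof (cases "v = y")
    case True
    \<comment> \<open>A root in first position must be alone, as the last letter would be a second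
      sink.\<close>
    have "w = []"
    proof (rule ccontr)
      assume "w \<noteq> []"
      then obtain u z where w: "w = u @ [z]" by (cases w rule: rev_cases) auto
      have "z \<notin> Domain (word_orientation A ((y # u) @ [z]))"
        using Cons.prems(1) w by (intro last_not_in_Domain) simp
      moreover have "z \<in> set (y # w) - {v}" using Cons.prems(1) w True by auto
      ultimately show False using Cons.prems(2) w by auto
    qed
    then show ?thesis using Cons.prems(4) True by simp
  next
    case False
    have "set w - {v} \<subseteq> Domain (word_orientation A w)"
      using Cons.prems(1,2) by auto
    then have IH: "(z, v) \<in> (word_orientation A w)\<^sup>*" if "z \<in> set w" for z
      using Cons.IH Cons.prems(1,3) False that by simp
    have mono: "(word_orientation A w)\<^sup>* \<subseteq> (word_orientation A (y # w))\<^sup>*"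
      by (intro rtrancl_mono) simp
    show ?thesis
    proof (cases "x = y")
      case True
      have "y \<notin> Domain (word_orientation A w)"
        using Cons.prems(1) word_orientation_subset[of A w] by auto
      moreover have "y \<in> Domain (word_orientation A (y # w))" using Cons.prems(2) False by auto
      ultimately obtain z where "z \<in> set w" "(y, z) \<in> word_orientation A (y # w)" by auto
      then show ?thesis using IH[of z] mono True by (meson converse_rtrancl_into_rtrancl subsetD)
    next
      case False
      then show ?thesis using IH[of x] mono Cons.prems(4) by auto
    qed
  qed
qed simp

lemma rooted_orientations_reach:
  assumes "rooted_orientations A v T \<noteq> {}" "v \<in> T" "x \<in> T"
  shows "(x, v) \<in> {(x, y). x \<in> T \<and> y \<in> T \<and> A x y}\<^sup>*"
proof -
  obtain w where w: "distinct w" "set w = T" "T - {v} \<subseteq> Domain (word_orientation A w)"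
    using assms(1) by (auto simp: rooted_orientations_def acyclic_orientations_def)
  have "(x, v) \<in> (word_orientation A w)\<^sup>*"
    using word_orientation_reaches_root[of w v A x] w assms(2,3) by simp
  moreover have "word_orientation A w \<subseteq> {(x, y). x \<in> T \<and> y \<in> T \<and> A x y}"
    using word_orientation_subset[of A w] word_orientation_adj[of _ _ A w] w(2) by auto
  ultimately show ?thesis using rtrancl_mono by blast
qed

lemma rooted_orientations_cong:
  assumes "\<And>x y. x \<in> T \<Longrightarrow> y \<in> T \<Longrightarrow> A x y = A' x y"
  shows "rooted_orientations A v T = rooted_orientations A' v T"
proof -
  have "word_orientation A w = word_orientation A' w" if "set w \<subseteq> T" for w
    using that by (induction w) (use assms in auto)
  then have "acyclic_orientations A T = acyclic_orientations A' T"
    unfolding acyclic_orientations_def by (intro image_cong) auto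
  then show ?thesis by (simp add: rooted_orientations_def)
qed

lemma (in wf_digraph) connected_if_rooted_orientation:
  assumes "rooted_orientations (dominates G) v T \<noteq> {}" "v \<in> T"
  shows "Digraph_Component.connected (G \<restriction> T)"
proof -
  let ?r = "(arcs_ends (G \<restriction> T))\<^sup>s"
  have sub: "{(x, y). x \<in> T \<and> y \<in> T \<and> x \<rightarrow>\<^bsub>G\<^esub> y} \<subseteq> ?r"
    by (auto simp: symcl_def arcs_ends_conv)
  have to_v: "(x, v) \<in> rtrancl_on T ?r" if "x \<in> T" for x
  proof (rule rtrancl_consistent_rtrancl_on)
    show "(x, v) \<in> ?r\<^sup>*"
      using rooted_orientations_reach[OF assms that] rtrancl_mono[OF sub] by blast
    show "b \<in> T" if "a \<in> T" "(a, b) \<in> ?r" for a b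
      using that by (auto simp: symcl_def arcs_ends_conv)
  qed (use that assms in auto)
  have "sym ?r" by (auto simp: sym_def symcl_def)
  then have "(v, x) \<in> rtrancl_on T ?r" if "x \<in> T" for x
    using to_v[OF that] rtrancl_on_sym[of ?r T] by (meson symD)
  then show ?thesis
    using to_v assms(2) by (auto simp: connected_conv intro: rtrancl_on_trans)
qed

lemma chromatic_polynomial_eqI:
  assumes "\<And>q. poly p (int q) = int (card (proper_colourings H q))"
  shows "chromatic_polynomial H = p"
  unfolding chromatic_polynomial_def
proof (rule the_equality)
  show "\<forall>q>0. poly p (int q) = int (card (proper_colourings H q))" using assms by simp
  fix p' assume p': "\<forall>q>0. poly p' (int q) = int (card (proper_colourings H q))"
  have "int ` {0<..} \<subseteq> {x. poly (p' - p) x = 0}"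
    using p' assms by auto
  moreover have "infinite (int ` {0::nat<..})"
    by (simp add: finite_image_iff infinite_Ioi)
  ultimately have "infinite {x. poly (p' - p) x = 0}" using finite_subset by blast
  then have "p' - p = 0" using poly_roots_finite by blast
  then show "p' = p" by simp
qed

lemma prod_partition_signed:
  fixes m :: "'a set \<Rightarrow> nat"
  assumes "finite V" "partition_on V \<pi>"
  shows "(\<Prod>T\<in>\<pi>. int q * ((- 1) ^ (card T - 1) * int (m T))) =
    (- 1) ^ (card V - card \<pi>) * int (\<Prod>T\<in>\<pi>. m T) * int q ^ card \<pi>"
proof -
  have fin: "finite \<pi>" "\<And>T. T \<in> \<pi> \<Longrightarrow> finite T" "\<And>T. T \<in> \<pi> \<Longrightarrow> T \<noteq> {}"
    using assms finite_elements by (auto simp: partition_on_def intro: finite_subset)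
  have "card V = (\<Sum>T\<in>\<pi>. card T)" using assms product_partition fin(2) by blast
  also have "\<dots> = (\<Sum>T\<in>\<pi>. (card T - 1) + 1)"
    \<comment> \<open>Blocks are nonempty, so the truncated subtraction is exact.\<close>
    using fin by (intro sum.cong) (auto simp: Suc_le_eq card_gt_0_iff)
  also have "\<dots> = (\<Sum>T\<in>\<pi>. card T - 1) + card \<pi>" unfolding sum.distrib by simp
  finally have "(\<Sum>T\<in>\<pi>. card T - 1) = card V - card \<pi>" by simp
  then show ?thesis
    by (simp add: prod.distrib power_sum[symmetric] mult_ac)
qed

text \<open>The common form of both parts. H is a spanning subgraph of G, and \<open>P\<close>
  selects sets on which H has all edges of G, among them every set connected in H. The
  multiplicities are those of G throughout.\<close>

lemma chromatic_polynomial_bond_sum: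
  fixes G H :: "('a, 'b) pre_digraph"
  assumes G: "graph G"
    and km: "kac_moody_algebra scale_h (verts G) (cartan_matrix G) simple_coroot simple_root scale bracket \<iota> e f"
    and H: "verts H = verts G" "\<And>u v. u \<rightarrow>\<^bsub>H\<^esub> v \<Longrightarrow> u \<rightarrow>\<^bsub>G\<^esub> v" "\<And>u v. u \<rightarrow>\<^bsub>H\<^esub> v \<Longrightarrow> v \<rightarrow>\<^bsub>H\<^esub> u"
    and P: "\<And>T u v. P T \<Longrightarrow> u \<in> T \<Longrightarrow> v \<in> T \<Longrightarrow> u \<rightarrow>\<^bsub>G\<^esub> v \<Longrightarrow> u \<rightarrow>\<^bsub>H\<^esub> v"
    and connected_P: "\<And>T v. T \<subseteq> verts G \<Longrightarrow> v \<in> T \<Longrightarrow>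
      (\<And>x. x \<in> T \<Longrightarrow> (x, v) \<in> {(x, y). x \<in> T \<and> y \<in> T \<and> x \<rightarrow>\<^bsub>H\<^esub> y}\<^sup>*) \<Longrightarrow> P T"
  shows "chromatic_polynomial H = (\<Sum>\<pi> | \<pi> \<in> bond_lattice G \<and> (\<forall>T\<in>\<pi>. P T).
    monom ((- 1) ^ (card (verts G) - card \<pi>) * int (partition_mult scale bracket \<iota> simple_root \<pi>)) (card \<pi>))"
proof (rule chromatic_polynomial_eqI)
  fix q
  interpret G: graph G by fact
  interpret AG: adjacency "dominates G"
    by unfold_locales (use G.adj_not_same arcs_ends_symmetric[OF G.sym_arcs] in blast)+
  interpret AH: adjacency "dominates H"
    by unfold_locales (use G.adj_not_same H in blast)+
  interpret K: simply_laced_kac_moody_algebra scale_h "verts G" "cartan_matrix G" simple_coroot simple_root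
    scale bracket \<iota> e f "dominates G"
    by (intro simply_laced_kac_moody_algebra.intro km AG.adjacency_axioms)
       (unfold_locales, auto simp: cartan_matrix_def adjacency_matrix_def dest: G.adj_not_same)
  let ?V = "verts G" and ?\<mu> = "\<lambda>T. root_mult scale bracket \<iota> (\<Sum>i\<in>T. simple_root i)"
  \<comment> \<open>The orientation counts of H in terms of roots of G: a set violating
    \<open>P\<close> is disconnected in H and has no rooted orientation there.\<close>
  define m where "m T = (if P T then ?\<mu> T else 0)" for T
  have m: "card (rooted_orientations (dominates H) v T) = m T" if "T \<subseteq> ?V" "v \<in> T" for T v
  proof (cases "P T")
    case True
    then have "rooted_orientations (dominates H) v T = rooted_orientations (dominates G) v T"
      using P H(2) by (intro rooted_orientations_cong) blast
    then show ?thesis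
      using K.root_mult_eq_card_rooted_orientations[OF that] True by (simp add: m_def)
  next
    case False
    then have "rooted_orientations (dominates H) v T = {}"
      using rooted_orientations_reach[of "dominates H" v T] connected_P[OF that] that(2) by blast
    then show ?thesis using False by (simp add: m_def)
  qed
  \<comment> \<open>This cuts the sum over all partitions down to the bond lattice: a block that is
    disconnected in G has multiplicity 0.\<close>
  have connected: "Digraph_Component.connected (G \<restriction> T)" if "T \<subseteq> ?V" "v \<in> T" "m T \<noteq> 0" for T v
  proof (rule G.connected_if_rooted_orientation[OF _ that(2)])
    have "card (rooted_orientations (dominates G) v T) \<noteq> 0"
      using that K.root_mult_eq_card_rooted_orientations[OF that(1,2)] by (auto simp: m_def split: if_splits)
    then show "rooted_orientations (dominates G) v T \<noteq> {}" by auto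
  qed
  let ?L = "{\<pi>. \<pi> \<in> bond_lattice G \<and> (\<forall>T\<in>\<pi>. P T)}"
  let ?t = "\<lambda>\<pi>. (- 1) ^ (card ?V - card \<pi>) * int (\<Prod>T\<in>\<pi>. m T) * int q ^ card \<pi>"
  have finP: "finite {\<pi>. partition_on ?V \<pi>}" by (simp add: finitely_many_partition_on)
  have "proper_colourings H q = colourings (dominates H) ?V q"
  proof -
    have "(\<forall>u v. u \<rightarrow>\<^bsub>H\<^esub> v \<longrightarrow> c u \<noteq> c v) \<longleftrightarrow> (\<forall>u\<in>?V. \<forall>v\<in>?V. u \<rightarrow>\<^bsub>H\<^esub> v \<longrightarrow> c u \<noteq> c v)"
      for c :: "'a \<Rightarrow> nat"
      using H(2) G.adj_in_verts by meson
    then show ?thesis by (simp only: proper_colourings_def colourings_def H(1))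
  qed
  then have "int (card (proper_colourings H q)) = (\<Sum>\<pi> | partition_on ?V \<pi>. \<Prod>T\<in>\<pi>. int q * AH.signed_m m T)"
    using AH.card_colourings_partitions[OF G.finite_verts m subset_refl] by simp
  also have "\<dots> = (\<Sum>\<pi> | partition_on ?V \<pi>. ?t \<pi>)"
    by (intro sum.cong[OF HOL.refl] prod_partition_signed) simp_all
  also have "\<dots> = (\<Sum>\<pi>\<in>?L. ?t \<pi>)"
  proof (rule sum.mono_neutral_right[OF finP])
    show "?L \<subseteq> {\<pi>. partition_on ?V \<pi>}" by (auto simp: bond_lattice_def)
    show "\<forall>\<pi>\<in>{\<pi>. partition_on ?V \<pi>} - ?L. ?t \<pi> = 0"
    proof
      fix \<pi> assume "\<pi> \<in> {\<pi>. partition_on ?V \<pi>} - ?L"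
      then have \<pi>: "partition_on ?V \<pi>" "\<pi> \<notin> ?L" by auto
      then obtain T where T: "T \<in> \<pi>" "\<not> (Digraph_Component.connected (G \<restriction> T) \<and> P T)"
        by (auto simp: bond_lattice_def)
      have "T \<subseteq> ?V" "T \<noteq> {}" using \<pi>(1) T(1) by (auto simp: partition_on_def)
      then have "m T = 0" using connected T(2) by (auto simp: m_def)
      moreover have "finite \<pi>" using \<pi>(1) by (intro finite_elements) auto
      ultimately have "(\<Prod>T\<in>\<pi>. m T) = 0" using T(1) by (intro prod_zero) auto
      then show "?t \<pi> = 0" by simp
    qed
  qed
  also have "\<dots> = (\<Sum>\<pi>\<in>?L. poly (monom ((- 1) ^ (card ?V - card \<pi>) *
      int (partition_mult scale bracket \<iota> simple_root \<pi>)) (card \<pi>)) (int q))"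
  proof (rule sum.cong[OF HOL.refl])
    fix \<pi> assume "\<pi> \<in> ?L"
    then have "(\<Prod>T\<in>\<pi>. m T) = partition_mult scale bracket \<iota> simple_root \<pi>"
      unfolding partition_mult_def by (intro prod.cong) (auto simp: m_def)
    then show "?t \<pi> = poly (monom ((- 1) ^ (card ?V - card \<pi>) *
      int (partition_mult scale bracket \<iota> simple_root \<pi>)) (card \<pi>)) (int q)"
      by (simp only: poly_monom)
  qed
  finally show "poly (\<Sum>\<pi>\<in>?L. monom ((- 1) ^ (card ?V - card \<pi>) *
      int (partition_mult scale bracket \<iota> simple_root \<pi>)) (card \<pi>)) (int q) = int (card (proper_colourings H q))"
    by (simp only: poly_sum)
qed

theorem theorem1p1:
  fixes G :: "('a, 'b) pre_digraph"
    and l :: nat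
    and scale_h :: "complex \<Rightarrow> 'h::ab_group_add \<Rightarrow> 'h"
    and simple_coroot :: "'a \<Rightarrow> 'h"
    and simple_root :: "'a \<Rightarrow> 'h \<Rightarrow> complex"
    and scale :: "complex \<Rightarrow> 'g::ab_group_add \<Rightarrow> 'g"
    and bracket :: "'g \<Rightarrow> 'g \<Rightarrow> 'g"
    and \<iota> :: "'h \<Rightarrow> 'g"
    and e f :: "'a \<Rightarrow> 'g"
  assumes "graph G"
    and "card (verts G) = l"
    and "kac_moody_algebra scale_h (verts G) (cartan_matrix G) simple_coroot simple_root scale bracket \<iota> e f"
  shows "chromatic_polynomial G =
           (\<Sum>\<pi>\<in>bond_lattice G.
              monom ((-1) ^ (l - card \<pi>) * int (partition_mult scale bracket \<iota> simple_root \<pi>)) (card \<pi>))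
       \<and> (\<forall>\<Sigma>\<in>bond_lattice G.
            chromatic_polynomial (bond_subgraph G \<Sigma>) =
              (\<Sum>\<pi> | \<pi> \<in> bond_lattice G \<and> refines (verts G) (bond_bot G) \<pi> \<and> refines (verts G) \<pi> \<Sigma>.
                 monom ((-1) ^ (l - card \<pi>) * int (partition_mult scale bracket \<iota> simple_root \<pi>)) (card \<pi>)))"
proof (intro conjI ballI)
  interpret G: graph G by fact
  have sym: "u \<rightarrow>\<^bsub>G\<^esub> v \<Longrightarrow> v \<rightarrow>\<^bsub>G\<^esub> u" for u v
    using arcs_ends_symmetric[OF G.sym_arcs] .
  show "chromatic_polynomial G = (\<Sum>\<pi>\<in>bond_lattice G.
      monom ((-1) ^ (l - card \<pi>) * int (partition_mult scale bracket \<iota> simple_root \<pi>)) (card \<pi>))"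
    using chromatic_polynomial_bond_sum[OF assms(1,3), of G "\<lambda>_. True"] sym assms(2) by simp
  fix \<Sigma> assume "\<Sigma> \<in> bond_lattice G"
  then have \<Sigma>: "partition_on (verts G) \<Sigma>" by (simp add: bond_lattice_def)
  let ?H = "bond_subgraph G \<Sigma>"
  have dom: "u \<rightarrow>\<^bsub>?H\<^esub> v \<longleftrightarrow> (\<exists>S\<in>\<Sigma>. u \<in> S \<and> v \<in> S \<and> u \<rightarrow>\<^bsub>G\<^esub> v)" for u v
    by (auto simp: bond_subgraph_def pre_digraph.Union_def arcs_ends_conv)
  have verts: "verts ?H = verts G"
    using \<Sigma> by (auto simp: bond_subgraph_def pre_digraph.Union_def partition_on_def)
  \<comment> \<open>Arcs of the subgraph stay within a block of \<Sigma>, so a set connected in it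
    lies in the block of any of its vertices.\<close>
  have block: "\<exists>S\<in>\<Sigma>. T \<subseteq> S"
    if T: "T \<subseteq> verts G" "v \<in> T" and reach: "\<And>x. x \<in> T \<Longrightarrow> (x, v) \<in> {(x, y). x \<in> T \<and> y \<in> T \<and> x \<rightarrow>\<^bsub>?H\<^esub> y}\<^sup>*" for T v
  proof -
    obtain S where S: "S \<in> \<Sigma>" "v \<in> S" using \<Sigma> T by (auto simp: partition_on_def)
    have "x \<in> S" if "x \<in> T" for x
      using reach[OF that]
    proof (induction rule: converse_rtrancl_induct)
      case (step x y)
      then obtain S' where "S' \<in> \<Sigma>" "x \<in> S'" "y \<in> S'" by (auto simp: dom)
      then show ?case using S step.IH \<Sigma> by (auto simp: partition_on_def disjoint_def)
    qed (rule S(2))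
    then show ?thesis using S by blast
  qed
  have "chromatic_polynomial ?H = (\<Sum>\<pi> | \<pi> \<in> bond_lattice G \<and> (\<forall>T\<in>\<pi>. \<exists>S\<in>\<Sigma>. T \<subseteq> S).
      monom ((-1) ^ (card (verts G) - card \<pi>) * int (partition_mult scale bracket \<iota> simple_root \<pi>)) (card \<pi>))"
  proof (rule chromatic_polynomial_bond_sum[OF assms(1,3) verts _ _ _ block])
    show "u \<rightarrow>\<^bsub>G\<^esub> v" "v \<rightarrow>\<^bsub>?H\<^esub> u" if "u \<rightarrow>\<^bsub>?H\<^esub> v" for u v
      using that sym unfolding dom by auto
    show "u \<rightarrow>\<^bsub>?H\<^esub> v" if "\<exists>S\<in>\<Sigma>. T \<subseteq> S" "u \<in> T" "v \<in> T" "u \<rightarrow>\<^bsub>G\<^esub> v" for T u v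
      using that unfolding dom by auto
  qed
  \<comment> \<open>The singletons refine every partition, and \<pi> refines \<Sigma> exactly when
    each of its blocks lies in a block of \<Sigma>.\<close>
  moreover have "\<pi> \<in> bond_lattice G \<and> (\<forall>T\<in>\<pi>. \<exists>S\<in>\<Sigma>. T \<subseteq> S) \<longleftrightarrow>
      \<pi> \<in> bond_lattice G \<and> refines (verts G) (bond_bot G) \<pi> \<and> refines (verts G) \<pi> \<Sigma>" for \<pi>
    using \<Sigma> partition_on_singletons[of "verts G"]
    by (auto simp: bond_lattice_def refines_def bond_bot_def partition_on_def)
  ultimately show "chromatic_polynomial ?H =
      (\<Sum>\<pi> | \<pi> \<in> bond_lattice G \<and> refines (verts G) (bond_bot G) \<pi> \<and> refines (verts G) \<pi> \<Sigma>.
         monom ((-1) ^ (l - card \<pi>) * int (partition_mult scale bracket \<iota> simple_root \<pi>)) (card \<pi>))"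
    using assms(2) by (simp only:)
qed

end
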